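(* Assume $\mathscr{D}(A)=\mathscr{D}(A^* )$ and $A+A^*=-Q$, where $Q\ge0$ is a bounded operator on $\mathcal{X}$. Let $C\in\mathcal{L}(\mathcal{X},\mathcal{Y})$ and suppose that, for some $\delta>0$, $\int_0^T\|Ce^{At}x\|^2dt\ge\delta\|x\|^2$ for all $x\in\mathcal{X}$. Assume that $Q$ is small enough to satisfy $$e^{-\|Q/2\|T}\delta-3\|C\|^2\left(\frac{e^{\|Q/2\|T}-1}{\|Q/2\|}-T\right)>0.$$ Let $P(t)=e^{At}e^{A^*t}$ and let $\kappa_j>0$ satisfy $\sum_{j=1}^\infty\kappa_j=\infty$ and $\sum_{j=1}^\infty\kappa_j^2<\infty$. Consider the back and forth nudging iteration (defined in the context) with feedback operator $\kappa_jP(t)C^*$ in the forward observer and $\kappa_jP(T-t)C^*$ in the backward observer. Then the initial state estimate $z_j^-(T)$ given by the iteration converges strongly, as $j\to\infty$, to the minimizer over $x\in\mathcal{X}$ of the cost function $$J(x)=\frac12\int_0^T\|y(s)-Cz[x](s)\|^2ds,$$ where $z[x]$ is the solution of $\dot z[x]=Az[x]+f$, $z[x](0)=x$.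
   Context: $\mathcal{X}$ and $\mathcal{Y}$ are separable Hilbert spaces, $T>0$, and $\mathcal{L}(\mathcal{X},\mathcal{Y})$ is the space of bounded linear operators. $A$, with domain $\mathscr{D}(A)\subset\mathcal{X}$, generates a strongly continuous dissipative (contraction) semigroup $e^{At}$ on $\mathcal{X}$. Under the hypotheses, $-A$ also generates a strongly continuous semigroup. When $Q=0$, the quotient $(e^{\|Q/2\|T}-1)/\|Q/2\|$ is interpreted as its limit $T$. The measured output $y$ on $[0,T]$ comes from $\dot z=Az+f+\eta$, $z(0)=z_0$, $y=Cz+\nu$, where the load $f\in L^1(0,T;\mathcal{X})$ is known and $\eta,\nu$ are unknown noise terms. Apart from this, one only assumes that the load and noise terms are smooth enough that $y\in L^2(0,T;\mathcal{Y})$. All differential equations are understood in the mild sense. Back and forth nudging iteration with feedback corrected by $P$, for $j=1,2,\dots$ and $t\in[0,T]$: Forward observer: $\dot z_j^+(t)=Az_j^+(t)+f(t)+\kappa_jP(t)C^*\big(y(t)-Cz_j^+(t)\big)$, with $z_j^+(0)=z_{j-1}^-(T)$ for $j\ge2$ and $z_1^+(0)\in\mathcal{X}$ arbitrary. Backward observer: $\dot z_j^-(t)=-Az_j^-(t)-f(T-t)+\kappa_jP(T-t)C^*\big(y(T-t)-Cz_j^-(t)\big)$, with $z_j^-(0)=z_j^+(T)$. *)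

theory Defs
  imports "HOL-Analysis.Analysis"
begin

text \<open>
  Hilbert spaces are taken over the reals. A complex Hilbert space is covered by passing to the
  inner product \<open>Re \<langle>x, y\<rangle>\<close>: this changes neither norms nor adjoints (of bounded or of densely
  defined operators), generators, or the order on self-adjoint operators.

  An unbounded operator is a domain \<open>D\<close> together with a total function \<open>A\<close> of which only the values
  on \<open>D\<close> matter. Likewise only the values at \<open>t \<ge> 0\<close> of a semigroup matter.
\<close>

definition C0_semigroup :: "(real \<Rightarrow> 'a::real_normed_vector \<Rightarrow>\<^sub>L 'a) \<Rightarrow> bool" where
  "C0_semigroup S \<longleftrightarrow>
     S 0 = id_blinfun \<and>
     (\<forall>s\<ge>0. \<forall>t\<ge>0. S (s + t) = S s o\<^sub>L S t) \<and>
     (\<forall>x. ((\<lambda>t. S t x) \<longlongrightarrow> x) (at_right 0))"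

definition generates ::
  "'a::real_normed_vector set \<Rightarrow> ('a \<Rightarrow> 'a) \<Rightarrow> (real \<Rightarrow> 'a \<Rightarrow>\<^sub>L 'a) \<Rightarrow> bool" where
  "generates D A S \<longleftrightarrow>
     C0_semigroup S \<and>
     D = {x. \<exists>y. ((\<lambda>h. (S h x - x) /\<^sub>R h) \<longlongrightarrow> y) (at_right 0)} \<and>
     (\<forall>x\<in>D. ((\<lambda>h. (S h x - x) /\<^sub>R h) \<longlongrightarrow> A x) (at_right 0))"

definition generates_contraction ::
  "'a::real_normed_vector set \<Rightarrow> ('a \<Rightarrow> 'a) \<Rightarrow> bool" where
  "generates_contraction D A \<longleftrightarrow> (\<exists>S. generates D A S \<and> (\<forall>t\<ge>0. norm (S t) \<le> 1))"

text \<open>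
  The operator \<open>e\<^sup>A\<^sup>t\<close>. A semigroup is determined on \<open>t \<ge> 0\<close> by its generator, so the description is
  proper as soon as \<open>A\<close> generates a semigroup and \<open>t \<ge> 0\<close>.
\<close>

definition sg_exp ::
  "'a::real_normed_vector set \<Rightarrow> ('a \<Rightarrow> 'a) \<Rightarrow> real \<Rightarrow> 'a \<Rightarrow>\<^sub>L 'a" where
  "sg_exp D A t = (THE B. \<exists>S. generates D A S \<and> B = S t)"

text \<open>Adjoint of an unbounded operator; \<open>adj_op\<close> is well defined when \<open>D\<close> is dense.\<close>

definition adj_dom :: "'a::real_inner set \<Rightarrow> ('a \<Rightarrow> 'a) \<Rightarrow> 'a set" where
  "adj_dom D A = {y. \<exists>w. \<forall>x\<in>D. A x \<bullet> y = x \<bullet> w}"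

definition adj_op :: "'a::real_inner set \<Rightarrow> ('a \<Rightarrow> 'a) \<Rightarrow> 'a \<Rightarrow> 'a" where
  "adj_op D A y = (THE w. \<forall>x\<in>D. A x \<bullet> y = x \<bullet> w)"

definition nonneg_op :: "('a::real_inner \<Rightarrow>\<^sub>L 'a) \<Rightarrow> bool" where
  "nonneg_op Q \<longleftrightarrow> (\<forall>x y. Q x \<bullet> y = x \<bullet> Q y) \<and> (\<forall>x. 0 \<le> Q x \<bullet> x)"

definition L2_on ::
  "real set \<Rightarrow> (real \<Rightarrow> 'b::{real_normed_vector, second_countable_topology}) \<Rightarrow> bool" where
  "L2_on I y \<longleftrightarrow>
     set_borel_measurable lebesgue I y \<and> set_integrable lebesgue I (\<lambda>t. (norm (y t))\<^sup>2)"

text \<open>Variation of constants formula for \<open>z' = A z + g\<close>, \<open>z(0) = x\<close>.\<close>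

definition mild ::
  "'a::{banach, second_countable_topology} set \<Rightarrow> ('a \<Rightarrow> 'a) \<Rightarrow> (real \<Rightarrow> 'a) \<Rightarrow> 'a \<Rightarrow> real \<Rightarrow> 'a" where
  "mild D A g x t = sg_exp D A t x + (LINT s:{0..t}|lebesgue. sg_exp D A (t - s) (g s))"

text \<open>In an equation with feedback, \<open>g\<close> may itself depend on \<open>z\<close>.\<close>

definition mild_solution ::
  "'a::{banach, second_countable_topology} set \<Rightarrow> ('a \<Rightarrow> 'a) \<Rightarrow> real \<Rightarrow> (real \<Rightarrow> 'a) \<Rightarrow> 'a
     \<Rightarrow> (real \<Rightarrow> 'a) \<Rightarrow> bool" where
  "mild_solution D A T g x z \<longleftrightarrow>
     set_integrable lebesgue {0..T} g \<and>
     continuous_on {0..T} z \<and>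
     (\<forall>t\<in>{0..T}. z t = mild D A g x t)"

definition correction ::
  "'a::real_inner set \<Rightarrow> ('a \<Rightarrow> 'a) \<Rightarrow> real \<Rightarrow> 'a \<Rightarrow>\<^sub>L 'a" where
  "correction D A t = sg_exp D A t o\<^sub>L sg_exp (adj_dom D A) (adj_op D A) t"

text \<open>
  Back and forth nudging with feedback operators \<open>\<kappa>\<^sub>j P(t) C\<^sup>*\<close> (forward) and \<open>\<kappa>\<^sub>j P(T - t) C\<^sup>*\<close>
  (backward), started at \<open>x0\<close>. The iterations are numbered from 1; index 0 of \<open>\<kappa>\<close>, \<open>zp\<close>, \<open>zm\<close> is unused.
\<close>

definition bfn_iteration ::
  "'a::{real_inner, banach, second_countable_topology} set \<Rightarrow> ('a \<Rightarrow> 'a) \<Rightarrow> real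
     \<Rightarrow> (real \<Rightarrow> 'a) \<Rightarrow> (real \<Rightarrow> 'b) \<Rightarrow> ('a \<Rightarrow>\<^sub>L 'b::{real_inner, banach, second_countable_topology})
     \<Rightarrow> (real \<Rightarrow> 'a \<Rightarrow>\<^sub>L 'a) \<Rightarrow> (nat \<Rightarrow> real) \<Rightarrow> 'a
     \<Rightarrow> (nat \<Rightarrow> real \<Rightarrow> 'a) \<Rightarrow> (nat \<Rightarrow> real \<Rightarrow> 'a) \<Rightarrow> bool" where
  "bfn_iteration D A T f y C P \<kappa> x0 zp zm \<longleftrightarrow>
     (\<forall>j\<ge>1.
        mild_solution D A T
          (\<lambda>t. f t + \<kappa> j *\<^sub>R P t (adjoint C (y t - C (zp j t))))
          (if j = 1 then x0 else zm (j - 1) T) (zp j) \<and>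
        mild_solution D (\<lambda>x. - A x) T
          (\<lambda>t. - f (T - t) + \<kappa> j *\<^sub>R P (T - t) (adjoint C (y (T - t) - C (zm j t))))
          (zp j T) (zm j))"

definition cost ::
  "'a::{banach, second_countable_topology} set \<Rightarrow> ('a \<Rightarrow> 'a) \<Rightarrow> real \<Rightarrow> (real \<Rightarrow> 'a)
     \<Rightarrow> (real \<Rightarrow> 'b) \<Rightarrow> ('a \<Rightarrow>\<^sub>L 'b::real_normed_vector) \<Rightarrow> 'a \<Rightarrow> real" where
  "cost D A T f y C x = 1/2 * (LINT s:{0..T}|lebesgue. (norm (y s - C (mild D A f x s)))\<^sup>2)"

text \<open>The quotient \<open>(e\<^sup>q\<^sup>T - 1) / q\<close>, extended continuously to \<open>q = 0\<close>.\<close>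

definition exp_quot :: "real \<Rightarrow> real \<Rightarrow> real" where
  "exp_quot q T = (if q = 0 then T else (exp (q * T) - 1) / q)"

end

theory Submission
  imports Defs
begin

text \<open>
  Write \<open>S t\<close> for \<open>e\<^sup>A\<^sup>t\<close>. Since \<open>A + A\<^sup>* = - Q\<close> is bounded and \<open>A\<close>, \<open>A\<^sup>*\<close> have the same domain, both
  \<open>S t\<close> and its adjoint are bounded below, so \<open>S t\<close> is invertible, and the inverses \<open>U t\<close> form the
  semigroup generated by \<open>- A\<close> (\<open>contraction_semigroup_inverse\<close>). Every state can therefore be transported
  back to time \<open>0\<close>. There the correction \<open>P t = S t (S t)\<^sup>*\<close> does its work: \<open>U t (P t C\<^sup>* w) = (C S t)\<^sup>* w\<close>,
  so that after subtraction of the load both observers turn into one and the same kind of equation with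
  bounded coefficients,
    \<open>v' = \<kappa> H\<^sup>* (r - H v)\<close> with \<open>H t = C S t\<close> and \<open>r = y - C z[0]\<close>;
  the forward observer runs through it with increasing time and the backward observer with
  decreasing time (\<open>forward_sweep\<close>, \<open>backward_sweep\<close>).

  This equation is a gradient flow for the integrand of the cost, and for small \<open>\<kappa>\<close> a whole sweep is a
  gradient step up to second order: with the Gramian \<open>W = \<integral> H\<^sup>* H\<close> and \<open>b = \<integral> H\<^sup>* r\<close>,
    \<open>v T = v 0 + \<kappa> (b - W (v 0)) + O(\<kappa>\<^sup>2 (1 + \<parallel>v 0\<parallel>))\<close>
  (\<open>one_sweep_expansion\<close>). Observability says \<open>\<langle>W x, x\<rangle> \<ge> \<delta> \<parallel>x\<parallel>\<^sup>2\<close>. Hence \<open>W x = b\<close> has a solution, this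
  solution is the unique minimizer of the quadratic cost (\<open>cost_expansion\<close>), and the distance \<open>a\<^sub>j\<close> of the
  \<open>j\<close>-th estimate from it satisfies
    \<open>a\<^sub>j \<le> (1 - \<kappa>\<^sub>j \<delta> + O(\<kappa>\<^sub>j\<^sup>2)) a\<^sub>j\<^sub>-\<^sub>1 + O(\<kappa>\<^sub>j\<^sup>2)\<close>
  as soon as \<open>\<kappa>\<^sub>j\<close> is small (\<open>iteration_error\<close>). Divergence of \<open>\<Sum> \<kappa>\<^sub>j\<close> makes the factors multiply to \<open>0\<close>, and
  convergence of \<open>\<Sum> \<kappa>\<^sub>j\<^sup>2\<close> makes the accumulated remainders vanish (\<open>recursion_tendsto_0\<close>).

  The operators in the statement are described through their generators, so basic semigroup theory is
  built first: density of the domain, uniqueness of the semigroup (\<open>sg_exp_eq\<close>), and the fact that the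
  adjoint semigroup is generated by the adjoint operator (\<open>generates_adjoint\<close>).
\<close>

section \<open>Hilbert space operators\<close>

text \<open>
  The representing vector is the minimizer of \<open>\<parallel>x\<parallel>\<^sup>2 / 2 - f x\<close>: a minimizing sequence is Cauchy by the
  parallelogram law, and \<open>w\<close> is stationary in every direction.
\<close>

lemma riesz_representation:
  fixes f :: "'a::{real_inner, banach} \<Rightarrow> real"
  assumes "bounded_linear f"
  shows "\<exists>w. \<forall>x. f x = x \<bullet> w"
proof -
  interpret f: bounded_linear f by fact
  define \<phi> where "\<phi> x = (norm x)\<^sup>2 / 2 - f x" for x
  obtain K where K: "\<And>x. norm (f x) \<le> norm x * K" using f.bounded by blast
  have lower: "- (K\<^sup>2 / 2) \<le> \<phi> x" for x
  proof -
    have "0 \<le> (norm x - K)\<^sup>2" by simp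
    then show ?thesis using K[of x] by (simp add: \<phi>_def power2_eq_square algebra_simps)
  qed
  define m where "m = Inf (range \<phi>)"
  have bdd: "bdd_below (range \<phi>)" using lower by (auto intro!: bdd_belowI)
  have m_le: "m \<le> \<phi> x" for x
    unfolding m_def by (rule cInf_lower) (use bdd in auto)
  have "\<exists>x. \<phi> x < m + 1 / Suc n" for n
  proof -
    have "Inf (range \<phi>) < m + 1 / Suc n" by (simp add: m_def)
    then show ?thesis using cInf_less_iff[OF _ bdd] by auto
  qed
  then obtain u where u: "\<And>n. \<phi> (u n) < m + 1 / Suc n" by metis
  \<comment> \<open>The parallelogram law turns nearly minimal values into nearby points.\<close>
  have mid: "(norm (x - y))\<^sup>2 / 4 \<le> (\<phi> x - m) + (\<phi> y - m)" for x y
  proof -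
    have "\<phi> x + \<phi> y - 2 * \<phi> ((x + y) /\<^sub>R 2) = (norm (x - y))\<^sup>2 / 4"
      by (simp add: \<phi>_def f.add f.scaleR power2_norm_eq_inner inner_simps inner_commute
          algebra_simps)
    then show ?thesis using m_le[of "(x + y) /\<^sub>R 2"] by linarith
  qed
  have "Cauchy u"
  proof (rule metric_CauchyI)
    fix e :: real assume e: "0 < e"
    then obtain N where N: "1 / Suc N < e\<^sup>2 / 8"
      using nat_approx_posE[of "e\<^sup>2/8"] by (metis divide_pos_pos zero_less_numeral zero_less_power)
    show "\<exists>M. \<forall>i\<ge>M. \<forall>k\<ge>M. dist (u i) (u k) < e"
    proof (intro exI allI impI)
      fix i k assume ik: "N \<le> i" "N \<le> k"
      have "1 / real (Suc i) \<le> 1 / Suc N" "1 / real (Suc k) \<le> 1 / Suc N"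
        using ik by (auto intro!: divide_left_mono)
      then have "(norm (u i - u k))\<^sup>2 < e\<^sup>2"
        using mid[of "u i" "u k"] u[of i] u[of k] N by argo
      then show "dist (u i) (u k) < e"
        using e by (simp add: dist_norm power2_less_imp_less)
    qed
  qed
  then obtain w where w: "u \<longlonglongrightarrow> w" using Cauchy_convergent convergent_def by blast
  have "(\<lambda>n. \<phi> (u n)) \<longlonglongrightarrow> \<phi> w"
    unfolding \<phi>_def by (intro tendsto_intros f.tendsto w) auto
  moreover have "(\<lambda>n. m + 1 / Suc n) \<longlonglongrightarrow> m + 0"
    by (intro tendsto_intros LIMSEQ_inverse_real_of_nat[unfolded inverse_eq_divide])
  ultimately have "\<phi> w \<le> m + 0"
    by (rule LIMSEQ_le) (use u in \<open>auto intro: less_imp_le\<close>)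
  have "f v = v \<bullet> w" for v
  proof (cases "v = 0")
    case True then show ?thesis by (simp add: f.zero)
  next
    case False
    \<comment> \<open>The minimizer of \<open>\<phi>\<close> on the line through \<open>w\<close> in direction \<open>v\<close>.\<close>
    define t where "t = (f v - v \<bullet> w) / (v \<bullet> v)"
    have vv: "v \<bullet> v > 0" using False by simp
    have "\<phi> (w + t *\<^sub>R v) = \<phi> w + t * (v \<bullet> w - f v) + t\<^sup>2 * (v \<bullet> v) / 2"
      using dot_norm[of w "t *\<^sub>R v"]
      by (simp add: \<phi>_def f.add f.scaleR inner_commute power_mult_distrib dot_square_norm field_simps)
    also have "\<dots> = \<phi> w - (f v - v \<bullet> w)\<^sup>2 / (2 * (v \<bullet> v))"
      using vv by (simp add: t_def power2_eq_square field_simps)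
    finally have "(f v - v \<bullet> w)\<^sup>2 / (2 * (v \<bullet> v)) \<le> 0"
      using m_le[of "w + t *\<^sub>R v"] \<open>\<phi> w \<le> m + 0\<close> by linarith
    then have "(f v - v \<bullet> w)\<^sup>2 \<le> 0" using vv by (simp add: divide_le_0_iff)
    then show ?thesis by simp
  qed
  then show ?thesis by blast
qed

lemma adjoint_inner:
  fixes B :: "'a::{real_inner, banach} \<Rightarrow>\<^sub>L 'b::real_inner"
  shows "B x \<bullet> y = x \<bullet> adjoint (blinfun_apply B) y"
proof -
  have "\<exists>w. \<forall>x. B x \<bullet> y = x \<bullet> w" for y
    by (intro riesz_representation bounded_linear_inner_left_comp blinfun.bounded_linear_right)
  then have "\<exists>g. \<forall>x y. B x \<bullet> y = x \<bullet> g y" by metis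
  then show ?thesis unfolding adjoint_def by (rule someI2_ex) blast
qed

lemma adjoint_inner':
  fixes B :: "'a::{real_inner, banach} \<Rightarrow>\<^sub>L 'b::real_inner"
  shows "adjoint (blinfun_apply B) y \<bullet> x = y \<bullet> B x"
  by (metis adjoint_inner inner_commute)

lemma norm_adjoint_le:
  fixes B :: "'a::{real_inner, banach} \<Rightarrow>\<^sub>L 'b::real_inner"
  shows "norm (adjoint (blinfun_apply B) y) \<le> norm B * norm y"
proof (cases "adjoint B y = 0")
  case False
  let ?w = "adjoint B y"
  have "norm ?w * norm ?w = B ?w \<bullet> y"
    by (simp add: adjoint_inner flip: power2_norm_eq_inner power2_eq_square)
  also have "\<dots> \<le> norm (B ?w) * norm y" by (rule norm_cauchy_schwarz)
  also have "\<dots> \<le> (norm B * norm ?w) * norm y"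
    by (intro mult_right_mono norm_blinfun) auto
  finally have "norm ?w * norm ?w \<le> norm ?w * (norm B * norm y)"
    by (simp add: mult_ac)
  then show ?thesis using False by (simp add: mult_le_cancel_left_pos)
qed simp

lemma bounded_linear_adjoint:
  fixes B :: "'a::{real_inner, banach} \<Rightarrow>\<^sub>L 'b::real_inner"
  shows "bounded_linear (adjoint (blinfun_apply B))"
proof (rule bounded_linear_intro)
  show "adjoint B (x + y) = adjoint B x + adjoint B y" for x y
    by (rule vector_eq_rdot[THEN iffD1]) (simp add: adjoint_inner' inner_simps)
  show "adjoint B (r *\<^sub>R x) = r *\<^sub>R adjoint B x" for r x
    by (rule vector_eq_rdot[THEN iffD1]) (simp add: adjoint_inner' inner_simps)
  show "norm (adjoint B x) \<le> norm x * norm B" for x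
    using norm_adjoint_le[of B x] by (simp add: mult.commute)
qed

text \<open>
  The Hilbert space adjoint as a bounded operator, so that it can be composed and has an operator norm.
\<close>

definition adj_blinfun ::
  "('a::{real_inner, banach} \<Rightarrow>\<^sub>L 'b::real_inner) \<Rightarrow> 'b \<Rightarrow>\<^sub>L 'a" where
  "adj_blinfun B = Blinfun (adjoint (blinfun_apply B))"

lemma adj_blinfun_apply: "adj_blinfun B y = adjoint (blinfun_apply B) y"
  by (simp add: adj_blinfun_def bounded_linear_Blinfun_apply bounded_linear_adjoint)

lemma inner_adj_blinfun: "x \<bullet> adj_blinfun B y = B x \<bullet> y"
  by (simp add: adj_blinfun_apply adjoint_inner)

lemma inner_adj_blinfun': "adj_blinfun B y \<bullet> x = y \<bullet> B x"
  by (simp add: adj_blinfun_apply adjoint_inner')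

lemma norm_adj_blinfun_le: "norm (adj_blinfun B) \<le> norm B"
  by (rule norm_blinfun_bound) (simp_all add: adj_blinfun_apply norm_adjoint_le)

text \<open>
  Expanding the square yields \<open>\<parallel>e - k W e\<parallel>\<^sup>2 \<le> (1 - 2 k \<delta> + k\<^sup>2 w\<^sup>2) \<parallel>e\<parallel>\<^sup>2\<close>. This one estimate drives both
  the solvability of \<open>W x = b\<close> below and the convergence of the nudging iteration.
\<close>

lemma norm_richardson_step_le:
  fixes W :: "'a::real_inner \<Rightarrow> 'a"
  assumes "\<delta> * (norm e)\<^sup>2 \<le> W e \<bullet> e" and "norm (W e) \<le> w * norm e" and "0 \<le> k"
  shows "norm (e - k *\<^sub>R W e) \<le> (1 - k * \<delta> + k\<^sup>2 * w\<^sup>2) * norm e"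
proof (cases "e = 0")
  case True then show ?thesis using assms(2) by simp
next
  case False
  define r where "r = 1 - 2 * k * \<delta> + k\<^sup>2 * w\<^sup>2"
  have "(norm (W e))\<^sup>2 \<le> (w * norm e)\<^sup>2" using assms(2) by (intro power_mono) auto
  then have *: "k\<^sup>2 * (norm (W e))\<^sup>2 \<le> k\<^sup>2 * (w\<^sup>2 * (norm e)\<^sup>2)"
    by (simp add: mult_left_mono power_mult_distrib)
  have "(norm (e - k *\<^sub>R W e))\<^sup>2 = (norm e)\<^sup>2 - 2 * (k * (W e \<bullet> e)) + k\<^sup>2 * (norm (W e))\<^sup>2"
    using dot_norm_neg[of e "k *\<^sub>R W e"]
    by (simp add: inner_commute power_mult_distrib field_simps)
  also have "\<dots> \<le> r * (norm e)\<^sup>2"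
    using * mult_left_mono[OF assms(1) \<open>0 \<le> k\<close>] unfolding r_def by (simp add: algebra_simps)
  finally have sq: "(norm (e - k *\<^sub>R W e))\<^sup>2 \<le> r * (norm e)\<^sup>2" .
  have "0 \<le> r * (norm e)\<^sup>2" using sq by (rule order_trans[rotated]) simp
  then have r: "0 \<le> r" using False by (simp add: zero_le_mult_iff)
  \<comment> \<open>From \<open>\<surd>r \<le> (1 + r) / 2\<close>.\<close>
  have "r \<le> ((1 + r) / 2)\<^sup>2"
    using zero_le_power2[of "1 - r"] by (simp add: power2_eq_square field_simps)
  then have "(norm (e - k *\<^sub>R W e))\<^sup>2 \<le> ((1 + r) / 2 * norm e)\<^sup>2"
    using sq by (smt (verit) mult_right_mono power_mult_distrib zero_le_power2)
  then have "norm (e - k *\<^sub>R W e) \<le> (1 + r) / 2 * norm e"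
    by (rule power2_le_imp_le) (use r in simp)
  also have "\<dots> \<le> (1 - k * \<delta> + k\<^sup>2 * w\<^sup>2) * norm e"
    by (intro mult_right_mono) (simp_all add: r_def field_simps)
  finally show ?thesis .
qed

text \<open>
  The Lax--Milgram theorem: a solution of \<open>W x = b\<close> is a fixed point of the Richardson iteration
  \<open>x \<mapsto> x + k (b - W x)\<close>, a contraction for small \<open>k\<close>.
\<close>

lemma coercive_surj:
  fixes W :: "'a::{real_inner, banach} \<Rightarrow> 'a"
  assumes "bounded_linear W" and "\<And>x. \<delta> * (norm x)\<^sup>2 \<le> W x \<bullet> x" and "\<delta> > 0"
  shows "\<exists>x. W x = b"
proof -
  interpret W: bounded_linear W by fact
  obtain w where w: "\<And>x. norm (W x) \<le> w * norm x" and "w > 0"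
    using W.pos_bounded by (metis mult.commute)
  \<comment> \<open>Small enough that \<open>k\<^sup>2 w\<^sup>2\<close> costs at most half of the gain \<open>k \<delta>\<close>, which is itself below \<open>1\<close>.\<close>
  define k where "k = min (1 / (2 * \<delta>)) (\<delta> / (2 * w\<^sup>2))"
  have k: "k > 0" "k * \<delta> \<le> 1 / 2" "k * w\<^sup>2 \<le> \<delta> / 2"
  proof -
    show "k > 0" using \<open>\<delta> > 0\<close> \<open>w > 0\<close> by (simp add: k_def)
    have "k * \<delta> \<le> 1 / (2 * \<delta>) * \<delta>" using \<open>\<delta> > 0\<close> by (intro mult_right_mono) (auto simp: k_def)
    then show "k * \<delta> \<le> 1 / 2" using \<open>\<delta> > 0\<close> by simp
    have "k * w\<^sup>2 \<le> \<delta> / (2 * w\<^sup>2) * w\<^sup>2" by (intro mult_right_mono) (auto simp: k_def)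
    then show "k * w\<^sup>2 \<le> \<delta> / 2" using \<open>w > 0\<close> by simp
  qed
  define c where "c = 1 - k * \<delta> / 2"
  have c: "1 - k * \<delta> + k\<^sup>2 * w\<^sup>2 \<le> c"
    using mult_left_mono[OF k(3), of k] k(1) by (simp add: c_def power2_eq_square field_simps)
  have "\<exists>!x. x + k *\<^sub>R (b - W x) = x"
  proof (rule banach_fix_type)
    show "0 \<le> c" "c < 1" using k \<open>\<delta> > 0\<close> by (simp_all add: c_def)
    have "norm ((x + k *\<^sub>R (b - W x)) - (y + k *\<^sub>R (b - W y))) \<le> c * norm (x - y)" for x y
    proof -
      have "(x + k *\<^sub>R (b - W x)) - (y + k *\<^sub>R (b - W y)) = (x - y) - k *\<^sub>R W (x - y)"
        by (simp add: W.diff algebra_simps)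
      also have "norm \<dots> \<le> (1 - k * \<delta> + k\<^sup>2 * w\<^sup>2) * norm (x - y)"
        by (rule norm_richardson_step_le) (use assms w k in auto)
      also have "\<dots> \<le> c * norm (x - y)" using c by (intro mult_right_mono) auto
      finally show ?thesis .
    qed
    then show "\<forall>x y. dist (x + k *\<^sub>R (b - W x)) (y + k *\<^sub>R (b - W y)) \<le> c * dist x y"
      by (simp add: dist_norm)
  qed
  then show ?thesis using k(1) by auto
qed

text \<open>
  By the Baire category theorem one of the closed sets on which all \<open>B i\<close> are bounded by \<open>n\<close> contains
  a ball; differences of points of this ball bound the operator norms.
\<close>

lemma uniform_boundedness:
  fixes B :: "'i \<Rightarrow> 'a::banach \<Rightarrow>\<^sub>L 'b::real_normed_vector"
  assumes pw: "\<And>x. \<exists>K. \<forall>i. norm (B i x) \<le> K"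
  shows "\<exists>K. \<forall>i. norm (B i) \<le> K"
proof -
  define E where "E n = {x. \<forall>i. norm (B i x) \<le> real n}" for n
  have closed: "closed (E n)" for n
    unfolding E_def by (intro closed_Collect_all closed_Collect_le continuous_intros)
  have "(\<Union>n. E n) = UNIV"
  proof -
    have "\<exists>n. x \<in> E n" for x
    proof -
      obtain K where "\<forall>i. norm (B i x) \<le> K" using pw by blast
      moreover obtain n where "K \<le> real n" using real_arch_simple by blast
      ultimately show ?thesis unfolding E_def by (auto intro!: exI[of _ n] intro: order_trans)
    qed
    then show ?thesis by blast
  qed
  then have "\<exists>n. interior (E n) \<noteq> {}"
  proof (rule contrapos_pp)
    assume "\<not> (\<exists>n. interior (E n) \<noteq> {})"
    then have "euclidean interior_of \<Union>(range E) = {}"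
      using closed by (intro Baire_category_alt) (auto simp: completely_metrizable_space_euclidean)
    then show "(\<Union>n. E n) \<noteq> UNIV" by auto
  qed
  then obtain n x0 where "x0 \<in> interior (E n)" by blast
  then obtain r where r: "r > 0" "cball x0 r \<subseteq> E n"
    by (meson mem_interior_cball)
  have "norm (B i) \<le> 2 * real n / r" for i
  proof (rule norm_blinfun_bound)
    show "0 \<le> 2 * real n / r" using r by simp
    fix x show "norm (B i x) \<le> 2 * real n / r * norm x"
    proof (cases "x = 0")
      case False
      define v where "v = (r / norm x) *\<^sub>R x"
      have "x0 + v \<in> cball x0 r" "x0 \<in> cball x0 r" using r False by (auto simp: v_def dist_norm)
      then have "norm (B i (x0 + v)) \<le> n" "norm (B i x0) \<le> n" using r(2) unfolding E_def by blast+
      moreover have "B i v = B i (x0 + v) - B i x0" by (simp add: blinfun.add_right)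
      ultimately have "norm (B i v) \<le> 2 * real n"
        by (smt (verit) norm_triangle_ineq4)
      moreover have "norm (B i v) = r / norm x * norm (B i x)"
        using r by (simp add: v_def blinfun.scaleR_right)
      ultimately show ?thesis using r False by (simp add: field_simps)
    qed simp
  qed
  then show ?thesis by blast
qed

text \<open>
  Strong convergence of a bounded family allows the argument to vary as well. The
  derivatives of orbits and the measurability of \<open>s \<mapsto> S s (g s)\<close> rest on this.
\<close>

lemma tendsto_blinfun_strong:
  fixes B :: "'i \<Rightarrow> 'a::real_normed_vector \<Rightarrow>\<^sub>L 'b::real_normed_vector"
  assumes lim: "((\<lambda>i. B i l) \<longlongrightarrow> L) F"
    and bound: "eventually (\<lambda>i. norm (B i) \<le> M) F" and g: "(g \<longlongrightarrow> l) F"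
  shows "((\<lambda>i. B i (g i)) \<longlongrightarrow> L) F"
proof -
  have "((\<lambda>i. B i (g i - l)) \<longlongrightarrow> 0) F"
  proof (rule Lim_null_comparison)
    show "\<forall>\<^sub>F i in F. norm (B i (g i - l)) \<le> M * norm (g i - l)"
      using bound
    proof eventually_elim
      case (elim i)
      show ?case using norm_blinfun[of "B i" "g i - l"] mult_right_mono[OF elim, of "norm (g i - l)"]
        by simp
    qed
    have "((\<lambda>i. M * norm (g i - l)) \<longlongrightarrow> M * norm (l - l)) F"
      by (intro tendsto_intros g)
    then show "((\<lambda>i. M * norm (g i - l)) \<longlongrightarrow> 0) F" by simp
  qed
  from tendsto_add[OF this lim] show ?thesis by (simp add: blinfun.diff_right)
qed

section \<open>Strongly continuous semigroups\<close>

text \<open>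
  Only one-sided difference quotients occur in the definition of a generator; in this form they can be
  compared with derivatives.
\<close>

lemma has_vector_derivative_iff_quotient:
  "(f has_vector_derivative d) (at t within A) \<longleftrightarrow>
     ((\<lambda>s. (f s - f t) /\<^sub>R (s - t)) \<longlongrightarrow> d) (at t within A)"
proof -
  have "(f has_vector_derivative d) (at t within A) \<longleftrightarrow>
      ((\<lambda>s. (1 / norm (s - t)) *\<^sub>R (f s - (f t + (s - t) *\<^sub>R d))) \<longlongrightarrow> 0) (at t within A)"
    unfolding has_vector_derivative_def has_derivative_within
    by (simp add: bounded_linear_scaleR_left)
  also have "\<dots> \<longleftrightarrow> ((\<lambda>s. norm ((1 / norm (s - t)) *\<^sub>R (f s - (f t + (s - t) *\<^sub>R d)))) \<longlongrightarrow> 0) (at t within A)"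
    by (rule tendsto_norm_zero_iff[symmetric])
  also have "\<dots> \<longleftrightarrow> ((\<lambda>s. norm ((f s - f t) /\<^sub>R (s - t) - d)) \<longlongrightarrow> 0) (at t within A)"
  proof (rule tendsto_cong)
    have "norm ((1 / norm (s - t)) *\<^sub>R (f s - (f t + (s - t) *\<^sub>R d)))
        = norm ((f s - f t) /\<^sub>R (s - t) - d)" if "s \<noteq> t" for s
    proof -
      have "f s - (f t + (s - t) *\<^sub>R d) = (s - t) *\<^sub>R ((f s - f t) /\<^sub>R (s - t) - d)"
        using that by (simp add: scaleR_diff_right)
      then show ?thesis using that by simp
    qed
    then show "\<forall>\<^sub>F s in at t within A. norm ((1 / norm (s - t)) *\<^sub>R (f s - (f t + (s - t) *\<^sub>R d)))
        = norm ((f s - f t) /\<^sub>R (s - t) - d)"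
      by (auto simp: eventually_at_filter)
  qed
  also have "\<dots> \<longleftrightarrow> ((\<lambda>s. (f s - f t) /\<^sub>R (s - t)) \<longlongrightarrow> d) (at t within A)"
    by (simp add: tendsto_norm_zero_iff flip: Lim_null)
  finally show ?thesis .
qed

lemma C0_semigroup_0: "C0_semigroup S \<Longrightarrow> S 0 x = x"
  by (simp add: C0_semigroup_def)

lemma C0_semigroup_add: "C0_semigroup S \<Longrightarrow> 0 \<le> s \<Longrightarrow> 0 \<le> t \<Longrightarrow> S (s + t) x = S s (S t x)"
  by (simp add: C0_semigroup_def)

lemma C0_semigroup_continuous_0:
  "C0_semigroup S \<Longrightarrow> continuous (at 0 within {0..}) (\<lambda>t. S t x)"
  by (simp add: C0_semigroup_def continuous_within at_within_Ici_at_right)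

lemma C0_semigroup_tendsto_0:
  assumes "C0_semigroup S" and "\<And>i. 0 \<le> h i" and "(h \<longlongrightarrow> 0) F"
  shows "((\<lambda>i. S (h i) x) \<longlongrightarrow> x) F"
  using continuous_within_tendsto_compose'[OF C0_semigroup_continuous_0[OF assms(1)], of h F x] assms
  by (simp add: C0_semigroup_0[OF assms(1)])

text \<open>
  Otherwise there are \<open>t\<^sub>n \<rightarrow> 0\<close> with \<open>\<parallel>S t\<^sub>n\<parallel>\<close> unbounded, although \<open>S t\<^sub>n x\<close> converges for every \<open>x\<close>. Such
  a bound is needed for every semigroup with the given generator, as the contraction property is known
  for only one of them before uniqueness is established.
\<close>

lemma C0_semigroup_bounded_near_0:
  fixes S :: "real \<Rightarrow> 'a::banach \<Rightarrow>\<^sub>L 'a"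
  assumes "C0_semigroup S"
  shows "\<exists>\<eta>>0. \<exists>M. \<forall>t\<in>{0..\<eta>}. norm (S t) \<le> M"
proof (rule ccontr)
  assume neg: "\<not> ?thesis"
  have "\<exists>t\<in>{0..inverse (Suc n)}. real n < norm (S t)" for n
  proof (rule ccontr)
    assume "\<not> ?thesis"
    then have "\<forall>t\<in>{0..inverse (Suc n)}. norm (S t) \<le> real n" by (simp add: not_less)
    moreover have "inverse (Suc n) > (0::real)" by simp
    ultimately show False using neg by blast
  qed
  then obtain t where t: "\<And>n. t n \<in> {0..inverse (Suc n)}" "\<And>n. real n < norm (S (t n))" by metis
  have "t \<longlonglongrightarrow> 0"
    by (rule real_tendsto_sandwich[OF _ _ tendsto_const LIMSEQ_inverse_real_of_nat]) (use t in auto)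
  then have "(\<lambda>n. S (t n) x) \<longlonglongrightarrow> x" for x
    using C0_semigroup_tendsto_0[OF assms, of t] t by auto
  then have "\<exists>K. \<forall>n. norm (S (t n) x) \<le> K" for x
    using convergent_imp_Bseq[OF convergentI[of "\<lambda>n. S (t n) x" x]] unfolding Bseq_def by auto
  then obtain K where K: "\<And>n. norm (S (t n)) \<le> K"
    using uniform_boundedness[of "\<lambda>n. S (t n)"] by blast
  obtain n where "K < real n" using reals_Archimedean2 by blast
  then show False using K[of n] t(2)[of n] by simp
qed

lemma C0_semigroup_bounded:
  fixes S :: "real \<Rightarrow> 'a::banach \<Rightarrow>\<^sub>L 'a"
  assumes S: "C0_semigroup S"
  shows "\<exists>M. \<forall>t\<in>{0..b}. norm (S t) \<le> M"
proof -
  obtain \<eta> M0 where \<eta>: "\<eta> > 0" and M0: "\<And>t. t \<in> {0..\<eta>} \<Longrightarrow> norm (S t) \<le> M0"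
    using C0_semigroup_bounded_near_0[OF S] by blast
  define M where "M = max 1 M0"
  have M: "norm (S t) \<le> M" if "t \<in> {0..\<eta>}" for t using M0[OF that] by (simp add: M_def)
  have *: "\<forall>t\<in>{0..real n * \<eta>}. norm (S t) \<le> M ^ Suc n" for n
  proof (induction n)
    case 0
    have "norm (S 0) \<le> M" using \<eta> by (intro M) simp
    then show ?case by simp
  next
    case (Suc n)
    show ?case
    proof
      fix t assume t: "t \<in> {0..real (Suc n) * \<eta>}"
      show "norm (S t) \<le> M ^ Suc (Suc n)"
      proof (cases "t \<le> \<eta>")
        case True
        then have "norm (S t) \<le> M ^ 1" using M t by simp
        also have "\<dots> \<le> M ^ Suc (Suc n)" by (rule power_increasing) (auto simp: M_def)
        finally show ?thesis .
      next
        case False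
        then have "S t = S \<eta> o\<^sub>L S (t - \<eta>)"
          using C0_semigroup_add[OF S, of \<eta> "t - \<eta>"] \<eta> by (intro blinfun_eqI) simp
        then have "norm (S t) \<le> norm (S \<eta>) * norm (S (t - \<eta>))" by (simp add: norm_blinfun_compose)
        also have "\<dots> \<le> M * M ^ Suc n"
        proof (rule mult_mono)
          show "norm (S \<eta>) \<le> M" using M \<eta> by simp
          show "norm (S (t - \<eta>)) \<le> M ^ Suc n"
            using Suc.IH t False by (auto simp: algebra_simps)
        qed (auto simp: M_def)
        finally show ?thesis by simp
      qed
    qed
  qed
  obtain n where "b / \<eta> \<le> real n" using real_arch_simple by blast
  then have "b \<le> real n * \<eta>" using \<eta> by (simp add: field_simps)
  then show ?thesis using *[of n] by (intro exI[of _ "M ^ Suc n"]) auto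
qed

lemma C0_semigroup_continuous:
  fixes S :: "real \<Rightarrow> 'a::banach \<Rightarrow>\<^sub>L 'a"
  assumes S: "C0_semigroup S"
  shows "continuous_on {0..} (\<lambda>t. S t x)"
  unfolding continuous_on_def
proof
  fix t :: real assume "t \<in> {0..}"
  then have t: "0 \<le> t" by simp
  obtain M where M: "\<And>s. s \<in> {0..t+1} \<Longrightarrow> norm (S s) \<le> M"
    using C0_semigroup_bounded[OF S] by blast
  have near: "norm (S s x - S t x) \<le> M * norm (S \<bar>s - t\<bar> x - x)" if s: "s \<in> {0..t+1}" for s
  proof (cases "s \<le> t")
    case True
    have "S s x - S t x = S s (x - S (t - s) x)"
      using C0_semigroup_add[OF S, of s "t - s" x] True s by (simp add: blinfun.diff_right)
    then have "norm (S s x - S t x) \<le> norm (S s) * norm (x - S (t - s) x)"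
      by (simp add: norm_blinfun)
    also have "\<dots> \<le> M * norm (x - S (t - s) x)" using M[OF s] by (rule mult_right_mono) simp
    finally show ?thesis using True by (simp add: norm_minus_commute)
  next
    case False
    have "S s x - S t x = S t (S (s - t) x - x)"
      using C0_semigroup_add[OF S, of t "s - t" x] False t by (simp add: blinfun.diff_right)
    then have "norm (S s x - S t x) \<le> norm (S t) * norm (S (s - t) x - x)"
      by (simp add: norm_blinfun)
    also have "\<dots> \<le> M * norm (S (s - t) x - x)" using M[of t] t by (intro mult_right_mono) auto
    finally show ?thesis using False by simp
  qed
  have lim: "((\<lambda>s. M * norm (S \<bar>s - t\<bar> x - x)) \<longlongrightarrow> M * norm (x - x)) (at t within {0..})"
    by (intro tendsto_intros C0_semigroup_tendsto_0[OF S]) (auto intro!: tendsto_eq_intros)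
  have "((\<lambda>s. S s x - S t x) \<longlongrightarrow> 0) (at t within {0..})"
  proof (rule Lim_null_comparison)
    have "\<forall>\<^sub>F s in at t within {0..}. s < t + 1"
      using order_tendstoD(2)[OF tendsto_ident_at, of t "t+1"] by simp
    moreover have "\<forall>\<^sub>F s in at t within {0..}. s \<in> {0..}"
      by (simp add: eventually_at_filter)
    ultimately show "\<forall>\<^sub>F s in at t within {0..}. norm (S s x - S t x) \<le> M * norm (S \<bar>s - t\<bar> x - x)"
      by eventually_elim (auto intro: near)
  qed (use lim in simp)
  then show "((\<lambda>s. S s x) \<longlongrightarrow> S t x) (at t within {0..})" by (simp flip: Lim_null)
qed

lemma C0_semigroup_continuous_on:
  fixes S :: "real \<Rightarrow> 'a::banach \<Rightarrow>\<^sub>L 'a"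
  assumes "C0_semigroup S" "A \<subseteq> {0..}"
  shows "continuous_on A (\<lambda>t. S t x)"
  using C0_semigroup_continuous[OF assms(1)] assms(2) by (rule continuous_on_subset)

lemma generates_semigroup: "generates D A S \<Longrightarrow> C0_semigroup S"
  by (simp add: generates_def)

lemma generates_lim:
  "generates D A S \<Longrightarrow> x \<in> D \<Longrightarrow> ((\<lambda>h. (S h x - x) /\<^sub>R h) \<longlongrightarrow> A x) (at_right 0)"
  by (simp add: generates_def)

lemma generates_memI:
  "generates D A S \<Longrightarrow> ((\<lambda>h. (S h x - x) /\<^sub>R h) \<longlongrightarrow> y) (at_right 0) \<Longrightarrow> x \<in> D"
  by (auto simp: generates_def)

lemma generates_eqI:
  assumes "generates D A S" "((\<lambda>h. (S h x - x) /\<^sub>R h) \<longlongrightarrow> y) (at_right 0)"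
  shows "A x = y"
  using generates_lim[OF assms(1) generates_memI[OF assms]] assms(2)
  by (rule tendsto_unique[rotated]) simp

text \<open>
  \<open>S t\<close> commutes with the difference quotients at \<open>0\<close>, hence with their limit.
\<close>

lemma generates_invariant:
  fixes S :: "real \<Rightarrow> 'a::banach \<Rightarrow>\<^sub>L 'a"
  assumes gen: "generates D A S" and x: "x \<in> D" and t: "0 \<le> t"
  shows "S t x \<in> D" and "A (S t x) = S t (A x)"
proof -
  have lim: "((\<lambda>h. S t ((S h x - x) /\<^sub>R h)) \<longlongrightarrow> S t (A x)) (at_right 0)"
    using generates_lim[OF gen x] by (rule blinfun.tendsto[OF tendsto_const])
  have "((\<lambda>h. (S h (S t x) - S t x) /\<^sub>R h) \<longlongrightarrow> S t (A x)) (at_right 0)"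
  proof (rule Lim_transform_eventually[OF lim])
    have "S t ((S h x - x) /\<^sub>R h) = (S h (S t x) - S t x) /\<^sub>R h" if "0 < h" for h
      using C0_semigroup_add[OF generates_semigroup[OF gen], of t h x]
        C0_semigroup_add[OF generates_semigroup[OF gen], of h t x] t that
      by (simp add: blinfun.scaleR_right blinfun.diff_right add.commute)
    then show "\<forall>\<^sub>F h in at_right 0. S t ((S h x - x) /\<^sub>R h) = (S h (S t x) - S t x) /\<^sub>R h"
      by (auto simp: eventually_at_filter)
  qed
  then show "S t x \<in> D" "A (S t x) = S t (A x)"
    using generates_memI[OF gen] generates_eqI[OF gen] by blast+
qed

text \<open>
  Both one-sided difference quotients at \<open>t\<close> have the form \<open>S (min s t) (q \<bar>s - t\<bar>)\<close>, where \<open>q\<close> is the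
  quotient at \<open>0\<close>.
\<close>

lemma generates_has_vector_derivative:
  fixes S :: "real \<Rightarrow> 'a::banach \<Rightarrow>\<^sub>L 'a"
  assumes gen: "generates D A S" and x: "x \<in> D" and t: "0 \<le> t"
  shows "((\<lambda>s. S s x) has_vector_derivative S t (A x)) (at t within {0..})"
proof -
  note S = generates_semigroup[OF gen]
  define q where "q h = (S h x - x) /\<^sub>R h" for h
  obtain M where M: "\<And>s. s \<in> {0..t} \<Longrightarrow> norm (S s) \<le> M"
    using C0_semigroup_bounded[OF S] by blast
  have abs: "filterlim (\<lambda>s. \<bar>s - t\<bar>) (at_right 0) (at t within {0..})"
    unfolding filterlim_at
  proof
    show "\<forall>\<^sub>F s in at t within {0..}. \<bar>s - t\<bar> \<in> {0<..} \<and> \<bar>s - t\<bar> \<noteq> 0"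
      by (simp add: eventually_at_filter)
    have "((\<lambda>s. \<bar>s - t\<bar>) \<longlongrightarrow> \<bar>t - t\<bar>) (at t within {0..})" by (intro tendsto_intros)
    then show "((\<lambda>s. \<bar>s - t\<bar>) \<longlongrightarrow> 0) (at t within {0..})" by simp
  qed
  have "((\<lambda>s. S (min s t) (q \<bar>s - t\<bar>)) \<longlongrightarrow> S t (A x)) (at t within {0..})"
  proof (rule tendsto_blinfun_strong)
    show "((\<lambda>s. q \<bar>s - t\<bar>) \<longlongrightarrow> A x) (at t within {0..})"
      unfolding q_def using filterlim_compose[OF generates_lim[OF gen x] abs] by simp
    show "\<forall>\<^sub>F s in at t within {0..}. norm (S (min s t)) \<le> M"
      using M t by (auto simp: eventually_at_filter)
    have "continuous (at t within {0..}) (\<lambda>s. S s (A x))"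
      using C0_semigroup_continuous[OF S] t by (auto simp: continuous_on_eq_continuous_within)
    moreover have "((\<lambda>s. min s t) \<longlongrightarrow> t) (at t within {0..})"
      using tendsto_min[OF tendsto_ident_at[of t "{0..}"] tendsto_const[of t]] by simp
    moreover have "\<forall>\<^sub>F s in at t within {0..}. min s t \<in> {0..}"
      using t by (auto simp: eventually_at_filter)
    ultimately show "((\<lambda>s. S (min s t) (A x)) \<longlongrightarrow> S t (A x)) (at t within {0..})"
      by (intro continuous_within_tendsto_compose[where f = "\<lambda>s. S s (A x)"])
  qed
  then have "((\<lambda>s. (S s x - S t x) /\<^sub>R (s - t)) \<longlongrightarrow> S t (A x)) (at t within {0..})"
  proof (rule Lim_transform_eventually)
    have "S (min s t) (q \<bar>s - t\<bar>) = (S s x - S t x) /\<^sub>R (s - t)" if s: "0 \<le> s" "s \<noteq> t" for s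
    proof (cases "s \<le> t")
      case True
      have "S (min s t) (q \<bar>s - t\<bar>) = (S t x - S s x) /\<^sub>R (t - s)"
        using C0_semigroup_add[OF S, of s "t - s" x] True s
        by (simp add: q_def min_def blinfun.scaleR_right blinfun.diff_right)
      also have "\<dots> = (S s x - S t x) /\<^sub>R (s - t)"
        using inverse_minus_eq[of "s - t"] by (simp add: scaleR_diff_right)
      finally show ?thesis .
    next
      case False
      then show ?thesis
        using C0_semigroup_add[OF S, of t "s - t" x] t
        by (simp add: q_def min_def blinfun.scaleR_right blinfun.diff_right)
    qed
    then show "\<forall>\<^sub>F s in at t within {0..}. S (min s t) (q \<bar>s - t\<bar>) = (S s x - S t x) /\<^sub>R (s - t)"
      by (auto simp: eventually_at_filter)
  qed
  then show ?thesis by (simp add: has_vector_derivative_iff_quotient)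
qed

text \<open>
  The averages \<open>(\<integral>\<^sub>0\<^sup>h S s x ds) / h\<close> lie in the domain and converge to \<open>x\<close>.
\<close>

lemma generates_dense:
  fixes S :: "real \<Rightarrow> 'a::banach \<Rightarrow>\<^sub>L 'a"
  assumes gen: "generates D A S"
  shows "x \<in> closure D"
proof -
  note S = generates_semigroup[OF gen]
  define F where "F u = integral {0..u} (\<lambda>s. S s x)" for u
  have cont: "continuous_on {0..b} (\<lambda>s. S s x)" for b
    by (rule C0_semigroup_continuous_on[OF S]) auto
  have F': "((\<lambda>h. (F (t + h) - F t) /\<^sub>R h) \<longlongrightarrow> S t x) (at_right 0)" if t: "0 \<le> t" for t
  proof -
    have "(F has_vector_derivative S t x) (at t within {t..t+1})"
      unfolding F_def
      by (rule has_vector_derivative_within_subset[OF integral_has_vector_derivative[OF cont, of _ "t+1"]])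
        (use t in auto)
    then have "((\<lambda>s. (F s - F t) /\<^sub>R (s - t)) \<longlongrightarrow> S t x) (at_right t)"
      by (simp add: has_vector_derivative_iff_quotient at_within_Icc_at_right)
    then show ?thesis by (simp add: at_right_to_0[of t] filterlim_filtermap add.commute)
  qed
  have F_in_D: "F t \<in> D" if t: "0 < t" for t
  proof -
    have shift: "S h (F t) = F (t + h) - F h" if "0 \<le> h" for h
    proof -
      have "S h (F t) = integral {0..t} (\<lambda>s. S h (S s x))"
        unfolding F_def using integral_linear[OF integrable_continuous_real[OF cont] blinfun.bounded_linear_right, of t "S h"]
        by (simp add: o_def)
      also have "\<dots> = integral {0..t} ((\<lambda>s. S s x) \<circ> ((+) h))"
        by (rule integral_cong) (use that C0_semigroup_add[OF S] in auto)
      also have "\<dots> = integral {h..t+h} (\<lambda>s. S s x)"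
        by (simp add: integral_shift_Icc_real)
      also have "\<dots> = F (t + h) - F h"
        using Henstock_Kurzweil_Integration.integral_combine[of 0 h "t+h" "\<lambda>s. S s x"] that t integrable_continuous_real[OF cont]
        by (simp add: F_def algebra_simps)
      finally show ?thesis .
    qed
    have F0: "F 0 = 0" by (simp add: F_def)
    have "((\<lambda>h. (F (t + h) - F t) /\<^sub>R h - (F (0 + h) - F 0) /\<^sub>R h) \<longlongrightarrow> S t x - S 0 x) (at_right 0)"
      using t by (intro tendsto_diff F') auto
    then have "((\<lambda>h. (S h (F t) - F t) /\<^sub>R h) \<longlongrightarrow> S t x - S 0 x) (at_right 0)"
    proof (rule Lim_transform_eventually)
      show "\<forall>\<^sub>F h in at_right 0. (F (t + h) - F t) /\<^sub>R h - (F (0 + h) - F 0) /\<^sub>R h = (S h (F t) - F t) /\<^sub>R h"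
        by (auto simp: eventually_at_filter shift F0 algebra_simps simp flip: scaleR_diff_right)
    qed
    then show ?thesis by (rule generates_memI[OF gen])
  qed
  have "D \<noteq> {}" using F_in_D[of 1] by auto
  have scale: "c *\<^sub>R y \<in> D" if "y \<in> D" for c y
  proof -
    have "((\<lambda>h. c *\<^sub>R ((S h y - y) /\<^sub>R h)) \<longlongrightarrow> c *\<^sub>R A y) (at_right 0)"
      by (intro tendsto_intros generates_lim[OF gen that])
    then show ?thesis
      by (intro generates_memI[OF gen, of _ "c *\<^sub>R A y"]) (simp add: blinfun.scaleR_right algebra_simps)
  qed
  have "((\<lambda>h. F h /\<^sub>R h) \<longlongrightarrow> x) (at_right 0)"
    using F'[of 0] by (simp add: F_def C0_semigroup_0[OF S])
  moreover have "\<forall>\<^sub>F h in at_right 0. F h /\<^sub>R h \<in> closure D"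
  proof -
    have "F h /\<^sub>R h \<in> closure D" if "0 < h" for h
      using F_in_D[OF that] scale closure_subset[of D] by blast
    then show ?thesis by (simp add: eventually_at_filter)
  qed
  ultimately show ?thesis
    by (intro Lim_in_closed_set[OF closed_closure, of _ _ "at_right 0"]) auto
qed

text \<open>
  For \<open>x\<close> in the domain, \<open>s \<mapsto> S (t - s) (R s x)\<close> has derivative \<open>S (t - s) (A R s x - A R s x) = 0\<close>; its
  values at the two ends are \<open>S t x\<close> and \<open>R t x\<close>.
\<close>

lemma generates_unique:
  fixes S R :: "real \<Rightarrow> 'a::banach \<Rightarrow>\<^sub>L 'a"
  assumes genS: "generates D A S" and genR: "generates D A R" and t: "0 \<le> t"
  shows "S t = R t"
proof -
  note S = generates_semigroup[OF genS] and R = generates_semigroup[OF genR]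
  obtain M where M: "\<And>s. s \<in> {0..t} \<Longrightarrow> norm (S s) \<le> M"
    using C0_semigroup_bounded[OF S] by blast
  have eqD: "S t x = R t x" if x: "x \<in> D" for x
  proof -
    define \<phi> where "\<phi> s = S (t - s) (R s x)" for s
    have deriv: "(\<phi> has_vector_derivative 0) (at s within {0..t})" if s: "s \<in> {0..t}" for s
    proof -
      let ?r = "\<lambda>s'. (R s' x - R s x) /\<^sub>R (s' - s)"
      have rD: "R s x \<in> D" "A (R s x) = R s (A x)"
        using generates_invariant[OF genR x] s by auto
      have "((\<lambda>s. R s x) has_vector_derivative R s (A x)) (at s within {0..t})"
        by (rule has_vector_derivative_within_subset[OF generates_has_vector_derivative[OF genR x]])
          (use s in auto)
      then have r: "(?r \<longlongrightarrow> R s (A x)) (at s within {0..t})"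
        by (simp add: has_vector_derivative_iff_quotient)
      have lim1: "((\<lambda>s'. S (t - s') (?r s')) \<longlongrightarrow> S (t - s) (R s (A x))) (at s within {0..t})"
      proof (rule tendsto_blinfun_strong[OF _ _ r])
        show "\<forall>\<^sub>F s' in at s within {0..t}. norm (S (t - s')) \<le> M"
          using M by (auto simp: eventually_at_filter)
        have "continuous_on {0..t} (\<lambda>s'. S (t - s') (R s (A x)))"
          by (intro continuous_on_compose2[OF C0_semigroup_continuous[OF S]] continuous_intros) auto
        then show "((\<lambda>s'. S (t - s') (R s (A x))) \<longlongrightarrow> S (t - s) (R s (A x))) (at s within {0..t})"
          using s by (simp add: continuous_on_def)
      qed
      have "((\<lambda>s'. S s' (R s x)) has_vector_derivative S (t - s) (A (R s x))) (at (t - s) within ((\<lambda>s'. t - s') ` {0..t}))"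
        by (rule has_vector_derivative_within_subset[OF generates_has_vector_derivative[OF genS rD(1)]])
          (use s in auto)
      moreover have "((\<lambda>s'. t - s') has_vector_derivative - 1) (at s within {0..t})"
        by (auto intro!: derivative_eq_intros)
      ultimately have "((\<lambda>s'. S s' (R s x)) \<circ> (\<lambda>s'. t - s') has_vector_derivative (-1) *\<^sub>R S (t - s) (A (R s x))) (at s within {0..t})"
        by (intro vector_diff_chain_within) auto
      then have lim2: "((\<lambda>s'. (S (t - s') (R s x) - S (t - s) (R s x)) /\<^sub>R (s' - s)) \<longlongrightarrow> - S (t - s) (R s (A x)))
          (at s within {0..t})"
        by (simp add: has_vector_derivative_iff_quotient rD(2))
      have "((\<lambda>s'. (\<phi> s' - \<phi> s) /\<^sub>R (s' - s)) \<longlongrightarrow> S (t - s) (R s (A x)) + - S (t - s) (R s (A x))) (at s within {0..t})"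
        using tendsto_add[OF lim1 lim2]
        by (simp add: \<phi>_def blinfun.scaleR_right blinfun.diff_right flip: scaleR_add_right)
      then show ?thesis by (simp add: has_vector_derivative_iff_quotient)
    qed
    obtain c where c: "\<And>s. s \<in> {0..t} \<Longrightarrow> \<phi> s = c"
    proof -
      have "\<exists>c. \<forall>s\<in>{0..t}. \<phi> s = c"
        by (rule has_derivative_zero_constant) (use deriv in \<open>auto simp: has_vector_derivative_def\<close>)
      then show ?thesis using that by blast
    qed
    have "\<phi> 0 = \<phi> t" using c t by simp
    then show ?thesis by (simp add: \<phi>_def C0_semigroup_0[OF S] C0_semigroup_0[OF R])
  qed
  show ?thesis
  proof (rule blinfun_eqI)
    fix x
    have "closed {x. S t x = R t x}"
      by (intro closed_Collect_eq continuous_intros)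
    then have "closure D \<subseteq> {x. S t x = R t x}" using eqD by (intro closure_minimal) auto
    then show "S t x = R t x" using generates_dense[OF genS] by blast
  qed
qed

lemma sg_exp_eq:
  fixes S :: "real \<Rightarrow> 'a::banach \<Rightarrow>\<^sub>L 'a"
  assumes "generates D A S" and "0 \<le> t"
  shows "sg_exp D A t = S t"
  unfolding sg_exp_def using assms generates_unique by (intro the_equality) blast+

section \<open>The adjoint semigroup\<close>

lemma norm_le_if_dense_inner_le:
  fixes u :: "'a::real_inner"
  assumes dense: "\<And>x. x \<in> closure D" and le: "\<And>x. x \<in> D \<Longrightarrow> x \<bullet> u \<le> c * norm x" and "0 \<le> c"
  shows "norm u \<le> c"
proof -
  have "closed {x. x \<bullet> u \<le> c * norm x}" by (intro closed_Collect_le continuous_intros)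
  then have "closure D \<subseteq> {x. x \<bullet> u \<le> c * norm x}" using le by (intro closure_minimal) auto
  then have "u \<bullet> u \<le> c * norm u" using dense by blast
  then have "norm u * norm u \<le> norm u * c" by (simp add: dot_square_norm power2_eq_square mult.commute)
  then show ?thesis using \<open>0 \<le> c\<close> by (cases "u = 0") (simp_all add: mult_le_cancel_left_pos)
qed

lemma adj_op_eq:
  fixes A :: "'a::real_inner \<Rightarrow> 'a"
  assumes dense: "\<And>x. x \<in> closure D" and w: "\<forall>x\<in>D. A x \<bullet> y = x \<bullet> w"
  shows "adj_op D A y = w"
  unfolding adj_op_def
proof (rule the_equality)
  show "\<forall>x\<in>D. A x \<bullet> y = x \<bullet> w" by (rule w)
next
  fix v assume v: "\<forall>x\<in>D. A x \<bullet> y = x \<bullet> v"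
  have "norm (v - w) \<le> 0"
    by (rule norm_le_if_dense_inner_le[OF dense]) (use v w in \<open>auto simp: inner_diff_right\<close>)
  then show "v = w" by simp
qed

lemma C0_semigroup_adjoint:
  fixes S :: "real \<Rightarrow> 'a::{real_inner, banach} \<Rightarrow>\<^sub>L 'a"
  assumes S: "C0_semigroup S" and contr: "\<forall>t\<ge>0. norm (S t) \<le> 1"
  shows "C0_semigroup (\<lambda>t. adj_blinfun (S t))"
  unfolding C0_semigroup_def
proof (intro conjI allI impI)
  have "x \<bullet> adj_blinfun (S 0) y = x \<bullet> y" for x y
    by (simp add: inner_adj_blinfun C0_semigroup_0[OF S])
  then show "adj_blinfun (S 0) = id_blinfun"
    by - (rule blinfun_eqI, rule vector_eq_ldot[THEN iffD1], simp)
next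
  fix s t :: real assume "0 \<le> s" "0 \<le> t"
  then have "x \<bullet> adj_blinfun (S (s + t)) y = x \<bullet> adj_blinfun (S s) (adj_blinfun (S t) y)" for x y
    using C0_semigroup_add[OF S, of t s x] by (simp add: inner_adj_blinfun add.commute)
  then show "adj_blinfun (S (s + t)) = adj_blinfun (S s) o\<^sub>L adj_blinfun (S t)"
    by - (rule blinfun_eqI, rule vector_eq_ldot[THEN iffD1], simp)
next
  fix y
  \<comment> \<open>For contractions, weak convergence to the identity is already strong.\<close>
  have le: "(norm (adj_blinfun (S t) y - y))\<^sup>2 \<le> 2 * (y \<bullet> (y - S t y))" if "0 \<le> t" for t
  proof -
    let ?w = "adj_blinfun (S t) y"
    have "norm ?w \<le> norm (adj_blinfun (S t)) * norm y" by (rule norm_blinfun)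
    also have "\<dots> \<le> 1 * norm y"
      using norm_adj_blinfun_le[of "S t"] contr that by (intro mult_right_mono) (auto intro: order_trans)
    finally have "(norm ?w)\<^sup>2 \<le> (norm y)\<^sup>2" by (simp add: power_mono)
    moreover have "(norm (?w - y))\<^sup>2 = (norm ?w)\<^sup>2 + (norm y)\<^sup>2 - 2 * (?w \<bullet> y)"
      using dot_norm_neg[of ?w y] by simp
    moreover have "?w \<bullet> y = y \<bullet> S t y" by (rule inner_adj_blinfun')
    ultimately show ?thesis by (simp add: inner_diff_right dot_square_norm)
  qed
  have "((\<lambda>t. (norm (adj_blinfun (S t) y - y))\<^sup>2) \<longlongrightarrow> 0) (at_right 0)"
  proof (rule tendsto_sandwich[where f = "\<lambda>_. 0"])
    have "((\<lambda>t. 2 * (y \<bullet> (y - S t y))) \<longlongrightarrow> 2 * (y \<bullet> (y - y))) (at_right 0)"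
      using S unfolding C0_semigroup_def by (intro tendsto_intros) auto
    then show "((\<lambda>t. 2 * (y \<bullet> (y - S t y))) \<longlongrightarrow> 0) (at_right 0)" by simp
    show "\<forall>\<^sub>F t in at_right 0. (norm (adj_blinfun (S t) y - y))\<^sup>2 \<le> 2 * (y \<bullet> (y - S t y))"
      using le by (simp add: eventually_at_filter)
  qed auto
  then have "((\<lambda>t. sqrt ((norm (adj_blinfun (S t) y - y))\<^sup>2)) \<longlongrightarrow> sqrt 0) (at_right 0)"
    by (rule tendsto_real_sqrt)
  then show "((\<lambda>t. adj_blinfun (S t) y) \<longlongrightarrow> y) (at_right 0)"
    by (simp add: tendsto_norm_zero_iff flip: Lim_null)
qed

text \<open>
  If \<open>(R h y - y) / h\<close> converges to \<open>w\<close>, then pairing with \<open>x\<close> in the domain shows \<open>A\<^sup>* y = w\<close>.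
  Conversely, if \<open>A\<^sup>* y = w\<close>, then \<open>s \<mapsto> \<langle>S s x, y\<rangle> - s \<langle>x, w\<rangle>\<close> has derivative \<open>\<langle>x, R s w - w\<rangle>\<close>, which is small
  uniformly for \<open>\<parallel>x\<parallel> \<le> 1\<close>; by density of the domain this turns the weak limit into a strong one.
\<close>

lemma generates_adjoint:
  fixes S :: "real \<Rightarrow> 'a::{real_inner, banach} \<Rightarrow>\<^sub>L 'a"
  assumes gen: "generates D A S" and contr: "\<forall>t\<ge>0. norm (S t) \<le> 1"
  shows "generates (adj_dom D A) (adj_op D A) (\<lambda>t. adj_blinfun (S t))"
proof -
  note S = generates_semigroup[OF gen]
  define R where "R t = adj_blinfun (S t)" for t
  have R: "C0_semigroup R" unfolding R_def by (rule C0_semigroup_adjoint[OF S contr])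
  have dense: "x \<in> closure D" for x by (rule generates_dense[OF gen])
  have weak: "A x \<bullet> y = x \<bullet> w"
    if lim: "((\<lambda>h. (R h y - y) /\<^sub>R h) \<longlongrightarrow> w) (at_right 0)" and x: "x \<in> D" for x y w
  proof -
    have "((\<lambda>h. x \<bullet> ((R h y - y) /\<^sub>R h)) \<longlongrightarrow> x \<bullet> w) (at_right 0)"
      by (intro tendsto_intros lim)
    moreover have "((\<lambda>h. x \<bullet> ((R h y - y) /\<^sub>R h)) \<longlongrightarrow> A x \<bullet> y) (at_right 0)"
    proof -
      have eq: "x \<bullet> ((R h y - y) /\<^sub>R h) = ((S h x - x) /\<^sub>R h) \<bullet> y" for h
        by (simp add: R_def inner_diff_left inner_diff_right inner_adj_blinfun)
      show ?thesis unfolding eq by (intro tendsto_intros generates_lim[OF gen x])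
    qed
    ultimately show ?thesis
      by (rule tendsto_unique[OF trivial_limit_at_right_real, rotated])
  qed
  have strong: "((\<lambda>h. (R h y - y) /\<^sub>R h) \<longlongrightarrow> w) (at_right 0)"
    if w: "\<forall>x\<in>D. A x \<bullet> y = x \<bullet> w" for y w
  proof (rule tendstoI)
    fix e :: real assume "0 < e"
    define e' where "e' = e / 2"
    have e': "0 < e'" "e' < e" using \<open>0 < e\<close> by (auto simp: e'_def)
    have "((\<lambda>s. R s w) \<longlongrightarrow> w) (at_right 0)" using R by (simp add: C0_semigroup_def)
    from tendstoD[OF this e'(1)]
    obtain d where d: "d > 0" "\<And>s. 0 < s \<Longrightarrow> s < d \<Longrightarrow> norm (R s w - w) < e'"
      unfolding eventually_at_right_field dist_norm by blast
    have "norm ((R h y - y) /\<^sub>R h - w) \<le> e'" if h: "0 < h" "h < d" for h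
    proof -
      have "x \<bullet> (R h y - y - h *\<^sub>R w) \<le> (e' * h) * norm x" if x: "x \<in> D" for x
      proof -
        define \<phi> where "\<phi> s = S s x \<bullet> y - s * (x \<bullet> w)" for s
        have "norm (\<phi> h - \<phi> 0) \<le> (e' * norm x) * norm (h - 0)"
        proof (rule field_differentiable_bound[of "{0..h}" \<phi> "\<lambda>s. x \<bullet> (R s w - w)"])
          fix s assume s: "s \<in> {0..h}"
          have "((\<lambda>s. S s x) has_vector_derivative S s (A x)) (at s within {0..h})"
            by (rule has_vector_derivative_within_subset[OF generates_has_vector_derivative[OF gen x]])
              (use s in auto)
          then have "((\<lambda>s. S s x \<bullet> y) has_vector_derivative S s (A x) \<bullet> y) (at s within {0..h})"
            by (rule bounded_linear.has_vector_derivative[OF bounded_linear_inner_left])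
          moreover have "((\<lambda>s. s * (x \<bullet> w)) has_vector_derivative x \<bullet> w) (at s within {0..h})"
            by (auto intro!: derivative_eq_intros)
          ultimately have "(\<phi> has_vector_derivative S s (A x) \<bullet> y - x \<bullet> w) (at s within {0..h})"
            unfolding \<phi>_def by (rule has_vector_derivative_diff)
          moreover have "S s (A x) \<bullet> y = S s x \<bullet> w"
            using generates_invariant[OF gen x, of s] s w by auto
          ultimately show "(\<phi> has_real_derivative x \<bullet> (R s w - w)) (at s within {0..h})"
            by (simp add: has_real_derivative_iff_has_vector_derivative R_def inner_diff_right inner_adj_blinfun)
          have "norm (R s w - w) \<le> e'"
            using d(2)[of s] s h e' by (cases "s = 0") (auto simp: C0_semigroup_0[OF R] intro: less_imp_le)
          then show "norm (x \<bullet> (R s w - w)) \<le> e' * norm x"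
            using Cauchy_Schwarz_ineq2[of x "R s w - w"] mult_left_mono[of "norm (R s w - w)" e' "norm x"]
            by (simp add: mult.commute)
        qed (use h in auto)
        moreover have "\<phi> h - \<phi> 0 = x \<bullet> (R h y - y - h *\<^sub>R w)"
          by (simp add: \<phi>_def R_def C0_semigroup_0[OF S] inner_diff_right inner_adj_blinfun)
        ultimately show ?thesis using h by (simp add: mult_ac)
      qed
      then have "norm (R h y - y - h *\<^sub>R w) \<le> e' * h"
        using e' h by (intro norm_le_if_dense_inner_le[OF dense]) auto
      moreover have "R h y - y - h *\<^sub>R w = h *\<^sub>R ((R h y - y) /\<^sub>R h - w)"
        using h by (simp add: scaleR_diff_right)
      ultimately show ?thesis using h by simp
    qed
    then show "\<forall>\<^sub>F h in at_right 0. dist ((R h y - y) /\<^sub>R h) w < e"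
      unfolding eventually_at_right_field dist_norm using d(1) e' by (intro exI[of _ d]) fastforce
  qed
  show ?thesis
    unfolding generates_def R_def[symmetric]
  proof (intro conjI ballI)
    show "C0_semigroup R" by (rule R)
    show "adj_dom D A = {y. \<exists>w. ((\<lambda>h. (R h y - y) /\<^sub>R h) \<longlongrightarrow> w) (at_right 0)}"
      unfolding adj_dom_def using strong weak by (intro Collect_cong iff_exI) blast
    fix y assume "y \<in> adj_dom D A"
    then obtain w where w: "\<forall>x\<in>D. A x \<bullet> y = x \<bullet> w" by (auto simp: adj_dom_def)
    show "((\<lambda>h. (R h y - y) /\<^sub>R h) \<longlongrightarrow> adj_op D A y) (at_right 0)"
      using strong[OF w] adj_op_eq[OF dense w] by simp
  qed
qed

section \<open>Backward solvability\<close>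

text \<open>
  The energy \<open>\<parallel>S s x\<parallel>\<^sup>2\<close> has derivative \<open>2 \<langle>A S s x, S s x\<rangle> \<ge> - q \<parallel>S s x\<parallel>\<^sup>2\<close>, so \<open>e\<^sup>q\<^sup>s \<parallel>S s x\<parallel>\<^sup>2\<close> increases.
\<close>

lemma semigroup_lower_bound:
  fixes S :: "real \<Rightarrow> 'a::{real_inner, banach} \<Rightarrow>\<^sub>L 'a"
  assumes gen: "generates D A S" and below: "\<And>x. x \<in> D \<Longrightarrow> - q * (norm x)\<^sup>2 \<le> 2 * (A x \<bullet> x)"
    and t: "0 \<le> t"
  shows "exp (- q * t) * (norm x)\<^sup>2 \<le> (norm (S t x))\<^sup>2"
proof -
  note S = generates_semigroup[OF gen]
  have onD: "exp (- q * t) * (norm x)\<^sup>2 \<le> (norm (S t x))\<^sup>2" if x: "x \<in> D" for x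
  proof -
    define g where "g s = exp (q * s) * (S s x \<bullet> S s x)" for s
    have "g 0 \<le> g t"
    proof (rule DERIV_nonneg_imp_increasing_open[OF t])
      fix s assume s: "0 < s" "s < t"
      let ?d = "exp (q * s) * (q * (S s x \<bullet> S s x) + 2 * (A (S s x) \<bullet> S s x))"
      have *: "{0<..} \<subseteq> {0::real..}" by auto
      have "((\<lambda>s. S s x) has_vector_derivative A (S s x)) (at s within {0<..})"
        unfolding generates_invariant(2)[OF gen x less_imp_le[OF s(1)]]
        by (rule has_vector_derivative_within_subset[OF generates_has_vector_derivative[OF gen x less_imp_le[OF s(1)]] *])
      then have "((\<lambda>s. S s x) has_vector_derivative A (S s x)) (at s)"
        by (rule has_vector_derivative_within_open[THEN iffD1, rotated 2]) (use s in auto)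
      then have "((\<lambda>s. S s x) has_derivative (\<lambda>h. h *\<^sub>R A (S s x))) (at s)"
        by (simp add: has_vector_derivative_def)
      from has_derivative_inner[OF this this]
      have "((\<lambda>s. S s x \<bullet> S s x) has_real_derivative 2 * (A (S s x) \<bullet> S s x)) (at s)"
        by (simp add: has_field_derivative_def inner_commute algebra_simps mult_commute_abs)
      then have "(g has_real_derivative ?d) (at s)"
        unfolding g_def by (auto intro!: derivative_eq_intros simp: algebra_simps)
      moreover have "0 \<le> ?d"
        using below[OF generates_invariant(1)[OF gen x, of s]] s by (simp add: dot_square_norm)
      ultimately show "\<exists>y. (g has_real_derivative y) (at s) \<and> 0 \<le> y" by blast
    next
      show "continuous_on {0..t} g"
        unfolding g_def by (intro continuous_intros C0_semigroup_continuous_on[OF S]) auto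
    qed
    then have "(norm x)\<^sup>2 \<le> exp (q * t) * (norm (S t x))\<^sup>2"
      by (simp add: g_def C0_semigroup_0[OF S] dot_square_norm)
    then have "exp (- q * t) * (norm x)\<^sup>2 \<le> exp (- q * t) * (exp (q * t) * (norm (S t x))\<^sup>2)"
      by (rule mult_left_mono) simp
    then show ?thesis by (simp add: mult.assoc[symmetric] exp_add[symmetric])
  qed
  have "closed {x. exp (- q * t) * (norm x)\<^sup>2 \<le> (norm (S t x))\<^sup>2}"
    by (intro closed_Collect_le continuous_intros)
  then have "closure D \<subseteq> {x. exp (- q * t) * (norm x)\<^sup>2 \<le> (norm (S t x))\<^sup>2}"
    using onD by (intro closure_minimal) auto
  then show ?thesis using generates_dense[OF gen, of x] by blast
qed

text \<open>
  The lower bound on the adjoint makes \<open>B B\<^sup>*\<close> coercive, hence \<open>B\<close> surjective; the lower bound on \<open>B\<close> makes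
  the inverse exist and be bounded.
\<close>

lemma blinfun_invertible:
  fixes B :: "'a::{real_inner, banach} \<Rightarrow>\<^sub>L 'a"
  assumes below: "\<And>x. c * (norm x)\<^sup>2 \<le> (norm (B x))\<^sup>2"
    and below_adj: "\<And>x. c * (norm x)\<^sup>2 \<le> (norm (adj_blinfun B x))\<^sup>2" and c: "c > 0"
  shows "\<exists>V :: 'a \<Rightarrow>\<^sub>L 'a. (\<forall>x. blinfun_apply V (B x) = x) \<and> (\<forall>x. B (blinfun_apply V x) = x) \<and> norm V \<le> 1 / sqrt c"
proof -
  have "\<exists>x. B (adj_blinfun B x) = y" for y
    by (rule coercive_surj[where \<delta> = c])
      (use below_adj c in \<open>auto intro!: bounded_linear_intros simp: power2_norm_eq_inner inner_adj_blinfun inner_commute\<close>)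
  then have surj: "\<exists>x. B x = y" for y by blast
  have norm_below: "norm x \<le> norm (B x) * (1 / sqrt c)" for x
  proof -
    have "(sqrt c * norm x)\<^sup>2 \<le> (norm (B x))\<^sup>2" using below[of x] c by (simp add: power_mult_distrib)
    then have "sqrt c * norm x \<le> norm (B x)" by (rule power2_le_imp_le) simp
    then show ?thesis using c by (simp add: field_simps)
  qed
  have inj: "x = y" if "B x = B y" for x y
    using norm_below[of "x - y"] that by (simp add: blinfun.diff_right)
  define g where "g y = (SOME x. B x = y)" for y
  have Bg: "B (g y) = y" for y unfolding g_def by (rule someI_ex[OF surj])
  have gB: "g (B x) = x" for x by (rule inj) (rule Bg)
  have "bounded_linear g"
  proof (rule bounded_linear_intro)
    show "g (x + y) = g x + g y" for x y by (rule inj) (simp add: Bg blinfun.add_right)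
    show "g (r *\<^sub>R x) = r *\<^sub>R g x" for r x by (rule inj) (simp add: Bg blinfun.scaleR_right)
    show "norm (g x) \<le> norm x * (1 / sqrt c)" for x using norm_below[of "g x"] by (simp add: Bg)
  qed
  then have V: "Blinfun g x = g x" for x by (simp add: bounded_linear_Blinfun_apply)
  have "norm (Blinfun g) \<le> 1 / sqrt c"
    by (rule norm_blinfun_bound) (use c norm_below[of "g x" for x] in \<open>auto simp: V Bg\<close>)
  then show ?thesis using V Bg gB by (intro exI[of _ "Blinfun g"]) simp
qed

text \<open>
  The quotients of \<open>S\<close> and \<open>U\<close> at \<open>0\<close> determine each other:
  \<open>(U h x - x) / h = - U h ((S h x - x) / h)\<close>, and symmetrically.
\<close>

lemma generates_inverse:
  fixes S U :: "real \<Rightarrow> 'a::banach \<Rightarrow>\<^sub>L 'a"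
  assumes gen: "generates D A S"
    and US: "\<And>t x. 0 \<le> t \<Longrightarrow> U t (S t x) = x" and SU: "\<And>t x. 0 \<le> t \<Longrightarrow> S t (U t x) = x"
    and U_le: "\<And>t. t \<in> {0..1} \<Longrightarrow> norm (U t) \<le> M"
  shows "generates D (\<lambda>x. - A x) U"
proof -
  note S = generates_semigroup[OF gen]
  obtain N where N: "\<And>t. t \<in> {0..1} \<Longrightarrow> norm (S t) \<le> N"
    using C0_semigroup_bounded[OF S] by blast
  have S_id: "((\<lambda>h. S h x) \<longlongrightarrow> x) (at_right 0)" for x using S by (simp add: C0_semigroup_def)
  have near: "\<forall>\<^sub>F h in at_right (0::real). h \<in> {0..1}"
    by (auto simp: eventually_at_right_field intro!: exI[of _ 1])
  have ev_U: "\<forall>\<^sub>F h in at_right 0. norm (U h) \<le> M" and ev_S: "\<forall>\<^sub>F h in at_right 0. norm (S h) \<le> N"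
    using near by (eventually_elim, use U_le N in blast)+
  have U_id: "((\<lambda>h. U h x) \<longlongrightarrow> x) (at_right 0)" for x
  proof -
    have "((\<lambda>h. U h (S h x - x)) \<longlongrightarrow> 0) (at_right 0)"
    proof (rule tendsto_blinfun_strong[OF _ ev_U])
      show "((\<lambda>h. S h x - x) \<longlongrightarrow> 0) (at_right 0)" using S_id[of x] by (simp flip: Lim_null)
    qed simp
    then have "((\<lambda>h. x - U h (S h x - x)) \<longlongrightarrow> x - 0) (at_right 0)" by (intro tendsto_intros)
    then have "((\<lambda>h. x - U h (S h x - x)) \<longlongrightarrow> x) (at_right 0)" by simp
    then show ?thesis
    proof (rule Lim_transform_eventually)
      show "\<forall>\<^sub>F h in at_right 0. x - U h (S h x - x) = U h x"
        using near by eventually_elim (simp add: blinfun.diff_right US)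
    qed
  qed
  have U: "C0_semigroup U"
    unfolding C0_semigroup_def
  proof (intro conjI allI impI U_id)
    show "U 0 = id_blinfun"
      using US[of 0] by (intro blinfun_eqI) (simp add: C0_semigroup_0[OF S])
    fix s t :: real assume st: "0 \<le> s" "0 \<le> t"
    show "U (s + t) = U s o\<^sub>L U t"
    proof (rule blinfun_eqI)
      fix x
      define v where "v = U (s + t) x"
      have "x = S (t + s) v" using SU[of "s + t" x] st by (simp add: v_def add.commute)
      also have "\<dots> = S t (S s v)" using st by (intro C0_semigroup_add[OF S])
      finally have "U s (U t x) = v" using st by (simp add: US)
      then show "U (s + t) x = (U s o\<^sub>L U t) x" by (simp add: v_def)
    qed
  qed
  have U_quot: "((\<lambda>h. (U h x - x) /\<^sub>R h) \<longlongrightarrow> - w) (at_right 0)"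
    if lim: "((\<lambda>h. (S h x - x) /\<^sub>R h) \<longlongrightarrow> w) (at_right 0)" for x w
  proof (rule Lim_transform_eventually)
    show "((\<lambda>h. - U h ((S h x - x) /\<^sub>R h)) \<longlongrightarrow> - w) (at_right 0)"
      by (intro tendsto_minus tendsto_blinfun_strong[OF U_id ev_U lim])
    show "\<forall>\<^sub>F h in at_right 0. - U h ((S h x - x) /\<^sub>R h) = (U h x - x) /\<^sub>R h"
      using near by eventually_elim (simp add: blinfun.diff_right blinfun.scaleR_right US scaleR_diff_right)
  qed
  have S_quot: "((\<lambda>h. (S h x - x) /\<^sub>R h) \<longlongrightarrow> - w) (at_right 0)"
    if lim: "((\<lambda>h. (U h x - x) /\<^sub>R h) \<longlongrightarrow> w) (at_right 0)" for x w
  proof (rule Lim_transform_eventually)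
    show "((\<lambda>h. - S h ((U h x - x) /\<^sub>R h)) \<longlongrightarrow> - w) (at_right 0)"
      by (intro tendsto_minus tendsto_blinfun_strong[OF S_id ev_S lim])
    show "\<forall>\<^sub>F h in at_right 0. - S h ((U h x - x) /\<^sub>R h) = (S h x - x) /\<^sub>R h"
      using near by eventually_elim (simp add: blinfun.diff_right blinfun.scaleR_right SU scaleR_diff_right)
  qed
  show ?thesis
    unfolding generates_def
  proof (intro conjI ballI U)
    show "D = {x. \<exists>y. ((\<lambda>h. (U h x - x) /\<^sub>R h) \<longlongrightarrow> y) (at_right 0)}"
      using U_quot S_quot generates_lim[OF gen] generates_memI[OF gen] by (intro set_eqI iffI) blast+
  qed (rule U_quot[OF generates_lim[OF gen]])
qed

text \<open>
  On the common domain \<open>2 \<langle>A x, x\<rangle> = 2 \<langle>A\<^sup>* x, x\<rangle> = - \<langle>Q x, x\<rangle> \<ge> - \<parallel>Q\<parallel> \<parallel>x\<parallel>\<^sup>2\<close>, which bounds both \<open>S t\<close> and its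
  adjoint from below.
\<close>

lemma contraction_semigroup_inverse:
  fixes D :: "'a::{real_inner, banach} set" and Q :: "'a \<Rightarrow>\<^sub>L 'a"
  assumes "generates_contraction D A" and "D = adj_dom D A"
    and sum: "\<forall>x\<in>D. A x + adj_op D A x = - Q x"
  obtains S U where "generates D A S" "\<And>t. 0 \<le> t \<Longrightarrow> norm (S t) \<le> 1"
    "generates (adj_dom D A) (adj_op D A) (\<lambda>t. adj_blinfun (S t))"
    "generates D (\<lambda>x. - A x) U"
    "\<And>t x. 0 \<le> t \<Longrightarrow> U t (S t x) = x" "\<And>t x. 0 \<le> t \<Longrightarrow> S t (U t x) = x"
proof -
  obtain S where gen: "generates D A S" and contr: "\<forall>t\<ge>0. norm (S t) \<le> 1"
    using assms(1) by (auto simp: generates_contraction_def)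
  note gen_adj = generates_adjoint[OF gen contr]
  define q where "q = norm Q"
  have adj: "A x \<bullet> y = x \<bullet> adj_op D A y" if "x \<in> D" "y \<in> D" for x y
  proof -
    obtain w where w: "\<forall>x\<in>D. A x \<bullet> y = x \<bullet> w" using \<open>y \<in> D\<close> assms(2) by (auto simp: adj_dom_def)
    then show ?thesis using adj_op_eq[OF generates_dense[OF gen] w] \<open>x \<in> D\<close> by simp
  qed
  have below: "- q * (norm x)\<^sup>2 \<le> 2 * (A x \<bullet> x)" if "x \<in> D" for x
  proof -
    have "2 * (A x \<bullet> x) = (A x + adj_op D A x) \<bullet> x"
      using adj[OF that that] inner_commute[of x "adj_op D A x"] by (simp add: inner_add_left)
    also have "\<dots> = - (Q x \<bullet> x)" using sum that by simp
    finally have *: "2 * (A x \<bullet> x) = - (Q x \<bullet> x)" .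
    have "Q x \<bullet> x \<le> norm (Q x) * norm x" by (rule norm_cauchy_schwarz)
    also have "\<dots> \<le> (q * norm x) * norm x" unfolding q_def by (intro mult_right_mono norm_blinfun) simp
    finally show ?thesis using * by (simp add: power2_eq_square)
  qed
  have below_adj: "- q * (norm x)\<^sup>2 \<le> 2 * (adj_op D A x \<bullet> x)" if "x \<in> adj_dom D A" for x
    using below[of x] adj[of x x] that assms(2) by (simp add: inner_commute)
  define P where "P t V \<longleftrightarrow> (\<forall>x. blinfun_apply V (S t x) = x) \<and> (\<forall>x. S t (blinfun_apply V x) = x) \<and>
    norm V \<le> 1 / sqrt (exp (- q * t))" for t and V :: "'a \<Rightarrow>\<^sub>L 'a"
  have "\<exists>V. P t V" if t: "0 \<le> t" for t
    unfolding P_def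
    by (rule blinfun_invertible)
      (use semigroup_lower_bound[OF gen below t] semigroup_lower_bound[OF gen_adj below_adj t] in auto)
  then obtain U where U: "\<And>t. 0 \<le> t \<Longrightarrow> P t (U t)" by metis
  have US: "U t (S t x) = x" and SU: "S t (U t x) = x" and U_le: "norm (U t) \<le> 1 / sqrt (exp (- q * t))"
    if "0 \<le> t" for t x
    using U[OF that] by (auto simp: P_def)
  have "generates D (\<lambda>x. - A x) U"
  proof (rule generates_inverse[OF gen US SU])
    fix t :: real assume t: "t \<in> {0..1}"
    have "exp (- q * 1) \<le> exp (- q * t)"
      using t mult_left_mono[of t 1 q] by (simp add: q_def)
    then have "1 / sqrt (exp (- q * t)) \<le> 1 / sqrt (exp (- q * 1))"
      by (intro divide_left_mono) auto
    then show "norm (U t) \<le> 1 / sqrt (exp (- q * 1))" using U_le[of t] t by simp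
  qed auto
  then show thesis using that[OF gen _ gen_adj _ US SU] contr by blast
qed

section \<open>Bochner integrals of operator families\<close>

text \<open>
  \<open>(s, x) \<mapsto> B s x\<close> is jointly continuous, and separability makes \<open>s \<mapsto> (s, g s)\<close> measurable.
\<close>

lemma set_borel_measurable_blinfun_strong:
  fixes B :: "real \<Rightarrow> 'a::{real_normed_vector, second_countable_topology} \<Rightarrow>\<^sub>L 'b::{real_normed_vector, second_countable_topology}"
  assumes T: "0 \<le> T" and cont: "\<And>x. continuous_on {0..T} (\<lambda>s. B s x)"
    and bound: "\<And>s. s \<in> {0..T} \<Longrightarrow> norm (B s) \<le> M"
    and g: "set_borel_measurable lebesgue {0..T} g"
  shows "set_borel_measurable lebesgue {0..T} (\<lambda>s. B s (g s))"
proof -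
  \<comment> \<open>Clipping the time extends \<open>B\<close> continuously to the whole line.\<close>
  define p where "p s = max 0 (min T s)" for s
  have p: "p s \<in> {0..T}" for s using T by (auto simp: p_def)
  have p_cont: "continuous_on UNIV p" unfolding p_def by (intro continuous_intros)
  define g' where "g' s = indicator {0..T} s *\<^sub>R g s" for s
  have g': "g' \<in> borel_measurable lebesgue"
    using g by (simp add: set_borel_measurable_def g'_def[abs_def])
  have "continuous_on UNIV (\<lambda>z. B (p (fst z)) (snd z))"
    unfolding continuous_on_def
  proof
    fix z :: "real \<times> 'a"
    show "((\<lambda>z. B (p (fst z)) (snd z)) \<longlongrightarrow> B (p (fst z)) (snd z)) (at z within UNIV)"
    proof (rule tendsto_blinfun_strong)
      have "continuous_on UNIV (\<lambda>z'. B (p (fst z')) (snd z))"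
        by (rule continuous_on_compose2[OF cont, of _ "\<lambda>z'. p (fst z')"])
          (use p in \<open>auto intro!: continuous_on_compose2[OF p_cont] continuous_intros\<close>)
      then show "((\<lambda>z'. B (p (fst z')) (snd z)) \<longlongrightarrow> B (p (fst z)) (snd z)) (at z within UNIV)"
        unfolding continuous_on_def by blast
      show "\<forall>\<^sub>F z' in at z within UNIV. norm (B (p (fst z'))) \<le> M" using bound p by simp
    qed (intro tendsto_intros)
  qed
  then have "(\<lambda>s. B (p (fst (s, g' s))) (snd (s, g' s))) \<in> borel_measurable lebesgue"
    by (rule borel_measurable_continuous_on) (intro borel_measurable_Pair g', simp add: measurable_completion)
  then have meas: "(\<lambda>s. B (p s) (g' s)) \<in> borel_measurable lebesgue" by simp
  have "(\<lambda>s. indicator {0..T} s *\<^sub>R B (p s) (g' s)) \<in> borel_measurable lebesgue"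
    by (rule borel_measurable_scaleR[OF borel_measurable_indicator meas]) simp
  also have "(\<lambda>s. indicator {0..T} s *\<^sub>R B (p s) (g' s)) = (\<lambda>s. indicator {0..T} s *\<^sub>R B s (g s))"
    by (auto simp: p_def g'_def indicator_def fun_eq_iff)
  finally show ?thesis by (simp add: set_borel_measurable_def)
qed

lemma set_integrable_measurable: "set_integrable M A f \<Longrightarrow> set_borel_measurable M A f"
  by (simp add: set_integrable_def set_borel_measurable_def)

lemma set_integrable_blinfun_strong:
  fixes B :: "real \<Rightarrow> 'a::{banach, second_countable_topology} \<Rightarrow>\<^sub>L 'b::{banach, second_countable_topology}"
  assumes T: "0 \<le> T" and cont: "\<And>x. continuous_on {0..T} (\<lambda>s. B s x)"
    and bound: "\<And>s. s \<in> {0..T} \<Longrightarrow> norm (B s) \<le> M"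
    and g: "set_integrable lebesgue {0..T} g"
  shows "set_integrable lebesgue {0..T} (\<lambda>s. B s (g s))"
proof (rule set_integrable_bound)
  show "set_integrable lebesgue {0..T} (\<lambda>s. M *\<^sub>R g s)" using g by simp
  show "set_borel_measurable lebesgue {0..T} (\<lambda>s. B s (g s))"
    using assms set_integrable_measurable by (intro set_borel_measurable_blinfun_strong[where M = M]) auto
  have "norm (B s (g s)) \<le> norm (M *\<^sub>R g s)" if s: "s \<in> {0..T}" for s
  proof -
    have "norm (B s (g s)) \<le> norm (B s) * norm (g s)" by (rule norm_blinfun)
    also have "\<dots> \<le> \<bar>M\<bar> * norm (g s)" using bound[OF s] by (intro mult_right_mono) auto
    finally show ?thesis by simp
  qed
  then show "AE s in lebesgue. s \<in> {0..T} \<longrightarrow> norm (B s (g s)) \<le> norm (M *\<^sub>R g s)" by simp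
qed

lemma set_integrable_continuous_on:
  fixes g :: "real \<Rightarrow> 'a::{banach, second_countable_topology}"
  assumes "continuous_on {a..b} g"
  shows "set_integrable lebesgue {a..b} g"
proof -
  have "set_integrable lborel {a..b} g"
    unfolding set_integrable_def using assms by (intro borel_integrable_compact) auto
  then show ?thesis
    unfolding set_integrable_def by (simp add: integrable_completion borel_measurable_integrable)
qed

lemma set_integral_blinfun:
  "set_integrable M A f \<Longrightarrow> (LINT s:A|M. blinfun_apply B (f s)) = B (LINT s:A|M. f s)"
  unfolding set_integrable_def set_lebesgue_integral_def
  by (subst integral_bounded_linear[symmetric, OF blinfun.bounded_linear_right])
    (auto simp: blinfun.scaleR_right)

lemma set_integrable_norm':
  fixes f :: "'a \<Rightarrow> 'b::{banach, second_countable_topology}"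
  shows "set_integrable M A f \<Longrightarrow> set_integrable M A (\<lambda>s. norm (f s))"
  unfolding set_integrable_def by (drule integrable_norm) simp

lemma norm_set_integral_le:
  fixes f :: "'a \<Rightarrow> 'b::{banach, second_countable_topology}"
  assumes "set_integrable M A f" "set_integrable M A g" "\<And>s. s \<in> A \<Longrightarrow> norm (f s) \<le> g s"
  shows "norm (LINT s:A|M. f s) \<le> (LINT s:A|M. g s)"
proof -
  have "norm (LINT s:A|M. f s) \<le> (LINT s:A|M. norm (f s))"
    unfolding set_lebesgue_integral_def
    by (rule order_trans[OF integral_norm_bound]) simp
  also have "\<dots> \<le> (LINT s:A|M. g s)"
    by (intro set_integral_mono set_integrable_norm' assms)
  finally show ?thesis .
qed

lemma set_integral_mono_set:
  fixes g :: "real \<Rightarrow> real"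
  assumes "set_integrable M B g" "A \<in> sets M" "A \<subseteq> B" "\<And>s. s \<in> B \<Longrightarrow> 0 \<le> g s"
  shows "(LINT s:A|M. g s) \<le> (LINT s:B|M. g s)"
  unfolding set_lebesgue_integral_def
  using set_integrable_subset[OF assms(1-3)] assms
  by (intro integral_mono) (auto simp: set_integrable_def indicator_def)

lemma set_integral_split:
  fixes g :: "real \<Rightarrow> 'a::{banach, second_countable_topology}"
  assumes g: "set_integrable lebesgue {0..T} g" and t: "t \<in> {0..T}"
  shows "(LINT s:{0..T}|lebesgue. g s) = (LINT s:{0..t}|lebesgue. g s) + (LINT s:{t..T}|lebesgue. g s)"
proof -
  have "(LINT s:{0..T}|lebesgue. g s) = (LINT s:{0..t} \<union> {t..T}|lebesgue. g s)"
    using t by (simp add: ivl_disj_un)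
  also have "\<dots> = (LINT s:{0..t}|lebesgue. g s) + (LINT s:{t..T}|lebesgue. g s)"
  proof (rule set_integral_Un_AE)
    have "AE s in lebesgue. s \<noteq> t" by (simp add: AE_completion AE_lborel_singleton)
    then show "AE s in lebesgue. \<not> (s \<in> {0..t} \<and> s \<in> {t..T})" by eventually_elim auto
  qed (use t in \<open>auto intro!: set_integrable_subset[OF g]\<close>)
  finally show ?thesis .
qed

text \<open>
  Dominated convergence: the indicators of \<open>{0..u n}\<close> converge to that of \<open>{0..t}\<close> except at \<open>t\<close>.
\<close>

lemma continuous_on_indefinite_integral:
  fixes g :: "real \<Rightarrow> 'a::{banach, second_countable_topology}"
  assumes g: "set_integrable lebesgue {0..T} g"
  shows "continuous_on {0..T} (\<lambda>t. LINT s:{0..t}|lebesgue. g s)"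
  unfolding continuous_on_sequentially
proof (intro allI ballI impI, elim conjE)
  fix u :: "nat \<Rightarrow> real" and t assume t: "t \<in> {0..T}" and u: "\<forall>n. u n \<in> {0..T}" and lim: "u \<longlonglongrightarrow> t"
  have "(\<lambda>n. LINT s:{0..u n}|lebesgue. g s) \<longlonglongrightarrow> (LINT s:{0..t}|lebesgue. g s)"
    unfolding set_lebesgue_integral_def
  proof (rule integral_dominated_convergence)
    have sub: "set_integrable lebesgue {0..r} g" if "r \<in> {0..T}" for r
      by (rule set_integrable_subset[OF g]) (use that in auto)
    show "(\<lambda>s. indicator {0..t} s *\<^sub>R g s) \<in> borel_measurable lebesgue"
      "(\<lambda>s. indicator {0..u n} s *\<^sub>R g s) \<in> borel_measurable lebesgue" for n
      using sub t u unfolding set_integrable_def by auto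
    show "integrable lebesgue (\<lambda>s. norm (indicator {0..T} s *\<^sub>R g s))"
      using g unfolding set_integrable_def by (rule integrable_norm)
    show "AE s in lebesgue. norm (indicator {0..u n} s *\<^sub>R g s) \<le> norm (indicator {0..T} s *\<^sub>R g s)" for n
      using u[rule_format, of n] by (intro AE_I2) (auto simp: indicator_def)
    have "AE s in lebesgue. s \<noteq> t" by (simp add: AE_completion AE_lborel_singleton)
    then show "AE s in lebesgue. (\<lambda>n. indicator {0..u n} s *\<^sub>R g s) \<longlonglongrightarrow> indicator {0..t} s *\<^sub>R g s"
    proof eventually_elim
      fix s assume "s \<noteq> t"
      then consider "s < t" | "t < s" by linarith
      then have "\<forall>\<^sub>F n in sequentially. indicator {0..u n} s = (indicator {0..t} s :: real)"
      proof cases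
        case 1
        then have "\<forall>\<^sub>F n in sequentially. s < u n" by (rule order_tendstoD(1)[OF lim])
        then show ?thesis by eventually_elim (use 1 in \<open>auto simp: indicator_def\<close>)
      next
        case 2
        then have "\<forall>\<^sub>F n in sequentially. u n < s" by (rule order_tendstoD(2)[OF lim])
        then show ?thesis by eventually_elim (use 2 in \<open>auto simp: indicator_def\<close>)
      qed
      then have "\<forall>\<^sub>F n in sequentially. indicator {0..u n} s *\<^sub>R g s = indicator {0..t} s *\<^sub>R g s"
        by eventually_elim simp
      then show "(\<lambda>n. indicator {0..u n} s *\<^sub>R g s) \<longlonglongrightarrow> indicator {0..t} s *\<^sub>R g s"
        by (rule tendsto_eventually)
    qed
  qed
  then show "((\<lambda>t. LINT s:{0..t}|lebesgue. g s) \<circ> u) \<longlonglongrightarrow> (LINT s:{0..t}|lebesgue. g s)"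
    by (simp add: o_def)
qed

lemma
  fixes g :: "real \<Rightarrow> 'a::{banach, second_countable_topology}"
  assumes g: "set_integrable lebesgue {T - b..T - a} g"
  shows set_integrable_reflect: "set_integrable lebesgue {a..b} (\<lambda>s. g (T - s))"
    and set_integral_reflect:
      "(LINT s:{a..b}|lebesgue. g (T - s)) = (LINT s:{T - b..T - a}|lebesgue. g s)"
proof -
  define h where "h s = indicator {T - b..T - a} s *\<^sub>R g s" for s
  have h: "integrable lebesgue h" using g by (simp add: set_integrable_def h_def[abs_def])
  have eq: "indicator {a..b} s *\<^sub>R g (T - s) = h (T + (-1) * s)" for s
    by (auto simp: h_def indicator_def)
  have refl: "lebesgue = distr lebesgue lebesgue (\<lambda>s::real. T + (-1) * s)"
    using lebesgue_real_affine[of "-1" T] by (simp add: density_1)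
  have meas: "(\<lambda>s::real. T + (-1) * s) \<in> lebesgue \<rightarrow>\<^sub>M lebesgue"
    using lebesgue_affine_measurable[where c = "\<lambda>_. -1::real" and t = T] by simp
  have "integrable (distr lebesgue lebesgue (\<lambda>s. T + (-1) * s)) h"
    using h refl by simp
  then have "integrable lebesgue (\<lambda>s. h (T + (-1) * s))" by (rule integrable_distr[OF meas])
  then show "set_integrable lebesgue {a..b} (\<lambda>s. g (T - s))"
    by (simp only: set_integrable_def eq)
  have "integral\<^sup>L (distr lebesgue lebesgue (\<lambda>s. T + (-1) * s)) h = (LINT s|lebesgue. h (T + (-1) * s))"
    by (rule integral_distr[OF meas]) (rule borel_measurable_integrable[OF h])
  then have "integral\<^sup>L lebesgue h = (LINT s|lebesgue. h (T + (-1) * s))"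
    by (simp only: refl[symmetric])
  also have "\<dots> = (LINT s:{a..b}|lebesgue. g (T - s))"
    by (simp only: set_lebesgue_integral_def eq)
  finally have "integral\<^sup>L lebesgue h = (LINT s:{a..b}|lebesgue. g (T - s))" .
  moreover have "integral\<^sup>L lebesgue h = (LINT s:{T - b..T - a}|lebesgue. g s)"
    by (simp only: set_lebesgue_integral_def h_def[abs_def])
  ultimately show "(LINT s:{a..b}|lebesgue. g (T - s)) = (LINT s:{T - b..T - a}|lebesgue. g s)"
    by (rule trans[OF sym])
qed

lemma L2_on_integrable:
  fixes y :: "real \<Rightarrow> 'b::{banach, second_countable_topology}"
  assumes "L2_on {a..b} y"
  shows "set_integrable lebesgue {a..b} y"
proof (rule set_integrable_bound)
  show "set_integrable lebesgue {a..b} (\<lambda>s. 1 + (norm (y s))\<^sup>2)"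
    using assms by (intro set_integral_add(1) set_integrable_continuous_on[of _ _ "\<lambda>_. 1"]) (auto simp: L2_on_def)
  show "set_borel_measurable lebesgue {a..b} y" using assms by (simp add: L2_on_def)
  have "norm (y s) \<le> 1 + (norm (y s))\<^sup>2" for s
    using zero_le_power2[of "norm (y s) - 1/2"] by (simp add: power2_eq_square algebra_simps)
  then show "AE s in lebesgue. s \<in> {a..b} \<longrightarrow> norm (y s) \<le> norm (1 + (norm (y s))\<^sup>2)" by simp
qed

lemma set_integral_inner_left:
  fixes f :: "real \<Rightarrow> 'a::{real_inner, banach, second_countable_topology}"
  assumes "set_integrable M A f"
  shows "(LINT s:A|M. f s \<bullet> x) = (LINT s:A|M. f s) \<bullet> x" and "set_integrable M A (\<lambda>s. f s \<bullet> x)"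
proof -
  have "(\<lambda>s. indicator A s *\<^sub>R (f s \<bullet> x)) = (\<lambda>s. (indicator A s *\<^sub>R f s) \<bullet> x)" by simp
  then show "(LINT s:A|M. f s \<bullet> x) = (LINT s:A|M. f s) \<bullet> x" "set_integrable M A (\<lambda>s. f s \<bullet> x)"
    using assms unfolding set_lebesgue_integral_def set_integrable_def
    by (simp_all only: integral_inner_left integrable_inner_left)
qed

lemma L2_minus_continuous:
  fixes y :: "real \<Rightarrow> 'b::{real_inner, banach, second_countable_topology}"
  assumes y: "L2_on {a..b} y" and q: "continuous_on {a..b} q"
  shows "set_integrable lebesgue {a..b} (\<lambda>s. (norm (y s - q s))\<^sup>2)"
proof (rule set_integrable_bound)
  show "set_integrable lebesgue {a..b} (\<lambda>s. 2 * (norm (y s))\<^sup>2 + 2 * (norm (q s))\<^sup>2)"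
  proof (rule set_integral_add(1))
    show "set_integrable lebesgue {a..b} (\<lambda>s. 2 * (norm (y s))\<^sup>2)"
      using y by (simp add: L2_on_def)
    show "set_integrable lebesgue {a..b} (\<lambda>s. 2 * (norm (q s))\<^sup>2)"
      by (intro set_integrable_continuous_on continuous_intros q)
  qed
  have "set_integrable lebesgue {a..b} (\<lambda>s. y s - q s)"
    by (intro set_integral_diff(1) L2_on_integrable y set_integrable_continuous_on q)
  then have "(\<lambda>s. indicator {a..b} s *\<^sub>R (y s - q s)) \<in> borel_measurable lebesgue"
    unfolding set_integrable_def by (rule borel_measurable_integrable)
  then have "(\<lambda>s. (norm (indicator {a..b} s *\<^sub>R (y s - q s)))\<^sup>2) \<in> borel_measurable lebesgue"
    by (rule borel_measurable_power[OF measurable_compose[OF _ borel_measurable_norm]])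
  also have "(\<lambda>s. (norm (indicator {a..b} s *\<^sub>R (y s - q s)))\<^sup>2)
      = (\<lambda>s. indicator {a..b} s *\<^sub>R (norm (y s - q s))\<^sup>2)"
    by (auto simp: indicator_def fun_eq_iff)
  finally show "set_borel_measurable lebesgue {a..b} (\<lambda>s. (norm (y s - q s))\<^sup>2)"
    by (simp add: set_borel_measurable_def)
  have "(norm (u - v))\<^sup>2 \<le> 2 * (norm u)\<^sup>2 + 2 * (norm v)\<^sup>2" for u v :: 'b
    using dot_norm[of u v] dot_norm_neg[of u v] zero_le_power2[of "norm (u + v)"] by argo
  then show "AE s in lebesgue. s \<in> {a..b} \<longrightarrow>
      norm ((norm (y s - q s))\<^sup>2) \<le> norm (2 * (norm (y s))\<^sup>2 + 2 * (norm (q s))\<^sup>2)" by simp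
qed

section \<open>One sweep as a gradient step\<close>

text \<open>
  Over the sweep \<open>v\<close> moves away from \<open>v0\<close> by only \<open>O(k)\<close>, so \<open>v\<close> may be replaced by \<open>v0\<close> under the
  integral, which already carries a factor \<open>k\<close>. The bound on \<open>k\<close> lets the maximum of \<open>\<parallel>v\<parallel>\<close> be absorbed
  into the left-hand side of its own estimate, which takes the place of Gronwall's inequality.
\<close>

lemma one_sweep_expansion:
  fixes H :: "real \<Rightarrow> 'a::{banach, second_countable_topology} \<Rightarrow>\<^sub>L 'b::{banach, second_countable_topology}"
    and K :: "real \<Rightarrow> 'b \<Rightarrow>\<^sub>L 'a"
  assumes T: "0 \<le> T" and c: "0 \<le> c"
    and H_cont: "\<And>x. continuous_on {0..T} (\<lambda>s. H s x)" and H_le: "\<And>s. s \<in> {0..T} \<Longrightarrow> norm (H s) \<le> c"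
    and K_cont: "\<And>x. continuous_on {0..T} (\<lambda>s. K s x)" and K_le: "\<And>s. s \<in> {0..T} \<Longrightarrow> norm (K s) \<le> c"
    and \<eta>: "set_integrable lebesgue {0..T} \<eta>" and v_cont: "continuous_on {0..T} v"
    and v: "\<And>t. t \<in> {0..T} \<Longrightarrow> v t = v0 + k *\<^sub>R (LINT s:{0..t}|lebesgue. K s (\<eta> s - H s (v s)))"
    and k: "0 \<le> k" "k * c\<^sup>2 * T \<le> 1 / 2"
  defines "N \<equiv> c * (LINT s:{0..T}|lebesgue. norm (\<eta> s))"
  shows "norm (v T - (v0 + k *\<^sub>R ((LINT s:{0..T}|lebesgue. K s (\<eta> s)) - (LINT s:{0..T}|lebesgue. K s (H s v0)))))
    \<le> k\<^sup>2 * (2 * c\<^sup>2 * T * (N + c\<^sup>2 * T * norm v0))"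
proof -
  have norm_KH: "norm (K s (H s x)) \<le> c\<^sup>2 * norm x" if s: "s \<in> {0..T}" for s x
  proof -
    have "norm (K s (H s x)) \<le> norm (K s) * norm (H s x)" by (rule norm_blinfun)
    also have "\<dots> \<le> c * (c * norm x)"
      using norm_blinfun[of "H s" x] mult_right_mono[OF H_le[OF s], of "norm x"] c
      by (intro mult_mono K_le[OF s]) auto
    finally show ?thesis by (simp add: power2_eq_square mult.assoc)
  qed
  have int_const: "(LINT s:{0..T}|lebesgue. r) = T * r" for r :: real
    using T by (simp add: set_integral_const)
  have int_Hv: "set_integrable lebesgue {0..T} (\<lambda>s. H s (u s))" if "continuous_on {0..T} u" for u
    by (rule set_integrable_blinfun_strong[OF T H_cont H_le set_integrable_continuous_on[OF that]])
  have int_K: "set_integrable lebesgue {0..T} (\<lambda>s. K s (w s))" if "set_integrable lebesgue {0..T} w" for w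
    by (rule set_integrable_blinfun_strong[OF T K_cont K_le that])
  have int_KHv: "set_integrable lebesgue {0..T} (\<lambda>s. K s (H s (u s)))" if "continuous_on {0..T} u" for u
    by (rule int_K[OF int_Hv[OF that]])
  note int_K\<eta> = int_K[OF \<eta>]
  have split: "(LINT s:{0..T}|lebesgue. K s (\<eta> s - H s (v s)))
      = (LINT s:{0..T}|lebesgue. K s (\<eta> s)) - (LINT s:{0..T}|lebesgue. K s (H s (v s)))"
    unfolding blinfun.diff_right by (rule set_integral_diff(2)[OF int_K\<eta> int_KHv[OF v_cont]])
  obtain m where m: "m \<in> {0..T}" "\<And>t. t \<in> {0..T} \<Longrightarrow> norm (v t) \<le> norm (v m)"
  proof -
    have "\<exists>m\<in>{0..T}. \<forall>t\<in>{0..T}. norm (v t) \<le> norm (v m)"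
      by (rule continuous_attains_sup) (use T v_cont in \<open>auto intro: continuous_intros\<close>)
    then show ?thesis using that by blast
  qed
  define V where "V = norm (v m)"
  have near: "norm (v t - v0) \<le> k * (N + c\<^sup>2 * T * V)" if t: "t \<in> {0..T}" for t
  proof -
    let ?g = "\<lambda>s. c * norm (\<eta> s) + c\<^sup>2 * V"
    have int1: "set_integrable lebesgue {0..T} (\<lambda>s. c * norm (\<eta> s))"
      using set_integrable_norm'[OF \<eta>] by simp
    have int2: "set_integrable lebesgue {0..T} (\<lambda>s. c\<^sup>2 * V)"
      by (intro set_integrable_continuous_on continuous_intros)
    note int_g = set_integral_add(1)[OF int1 int2]
    have "norm (LINT s:{0..t}|lebesgue. K s (\<eta> s - H s (v s))) \<le> (LINT s:{0..t}|lebesgue. ?g s)"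
    proof (rule norm_set_integral_le)
      show "set_integrable lebesgue {0..t} (\<lambda>s. K s (\<eta> s - H s (v s)))"
        by (rule set_integrable_subset[OF int_K[OF set_integral_diff(1)[OF \<eta> int_Hv[OF v_cont]]]])
          (use t in auto)
      show "set_integrable lebesgue {0..t} ?g"
        by (rule set_integrable_subset[OF int_g]) (use t in auto)
      fix s assume "s \<in> {0..t}"
      then have s: "s \<in> {0..T}" using t by auto
      have "norm (K s (\<eta> s - H s (v s))) \<le> norm (K s (\<eta> s)) + norm (K s (H s (v s)))"
        unfolding blinfun.diff_right by (rule norm_triangle_ineq4)
      also have "norm (K s (\<eta> s)) \<le> c * norm (\<eta> s)"
        using norm_blinfun[of "K s" "\<eta> s"] mult_right_mono[OF K_le[OF s], of "norm (\<eta> s)"] by simp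
      also have "norm (K s (H s (v s))) \<le> c\<^sup>2 * V"
        using norm_KH[OF s, of "v s"] mult_left_mono[OF m(2)[OF s], of "c\<^sup>2"] by (simp add: V_def)
      finally show "norm (K s (\<eta> s - H s (v s))) \<le> ?g s" by simp
    qed
    also have "\<dots> \<le> (LINT s:{0..T}|lebesgue. ?g s)"
      by (rule set_integral_mono_set[OF int_g]) (use t c in \<open>auto simp: V_def\<close>)
    also have "\<dots> = N + c\<^sup>2 * T * V"
      unfolding N_def
      by (subst set_integral_add(2)[OF int1 int2]) (simp add: int_const)
    finally show ?thesis using v[OF t] k(1) by (simp add: mult_left_mono)
  qed
  have N: "0 \<le> N"
    unfolding N_def set_lebesgue_integral_def using c by (intro mult_nonneg_nonneg integral_nonneg) auto
  have kN: "k * (c\<^sup>2 * T) * (k * N) \<le> 1 / 2 * (k * N)"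
    using k N by (intro mult_right_mono) (auto simp: mult.assoc)
  have "V \<le> norm v0 + norm (v m - v0)" unfolding V_def by (rule norm_triangle_sub)
  also have "norm (v m - v0) \<le> k * N + k * (c\<^sup>2 * T) * V"
    using near[OF m(1)] by (simp add: algebra_simps)
  also have "k * (c\<^sup>2 * T) * V \<le> 1 / 2 * V"
    using k by (intro mult_right_mono) (auto simp: V_def mult.assoc)
  finally have V: "V \<le> 2 * (norm v0 + k * N)" by simp
  have near': "norm (v t - v0) \<le> 2 * k * (N + c\<^sup>2 * T * norm v0)" if t: "t \<in> {0..T}" for t
  proof -
    have "norm (v t - v0) \<le> k * N + k * (c\<^sup>2 * T) * V" using near[OF t] by (simp add: algebra_simps)
    also have "k * (c\<^sup>2 * T) * V \<le> k * (c\<^sup>2 * T) * (2 * (norm v0 + k * N))"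
      using V k T by (intro mult_left_mono) auto
    also have "k * N + k * (c\<^sup>2 * T) * (2 * (norm v0 + k * N))
        = k * N + 2 * (k * (c\<^sup>2 * T) * norm v0) + 2 * (k * (c\<^sup>2 * T) * (k * N))"
      by (simp add: algebra_simps)
    also have "\<dots> \<le> 2 * k * (N + c\<^sup>2 * T * norm v0)" using kN by (simp add: algebra_simps)
    finally show ?thesis by simp
  qed
  have "v T - (v0 + k *\<^sub>R ((LINT s:{0..T}|lebesgue. K s (\<eta> s)) - (LINT s:{0..T}|lebesgue. K s (H s v0))))
      = - (k *\<^sub>R ((LINT s:{0..T}|lebesgue. K s (H s (v s))) - (LINT s:{0..T}|lebesgue. K s (H s v0))))"
    using T by (subst v) (auto simp: split algebra_simps)
  also have "\<dots> = - (k *\<^sub>R (LINT s:{0..T}|lebesgue. K s (H s (v s - v0))))"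
    unfolding blinfun.diff_right
    by (subst set_integral_diff(2)) (auto intro!: int_KHv v_cont)
  also have "norm \<dots> = k * norm (LINT s:{0..T}|lebesgue. K s (H s (v s - v0)))"
    using k by simp
  also have "\<dots> \<le> k * (LINT s:{0..T}|lebesgue. c\<^sup>2 * (2 * k * (N + c\<^sup>2 * T * norm v0)))"
  proof (rule mult_left_mono[OF norm_set_integral_le k(1)])
    show "set_integrable lebesgue {0..T} (\<lambda>s. K s (H s (v s - v0)))"
      by (intro int_KHv continuous_intros v_cont)
    show "set_integrable lebesgue {0..T} (\<lambda>s. c\<^sup>2 * (2 * k * (N + c\<^sup>2 * T * norm v0)))"
      by (intro set_integrable_continuous_on continuous_intros)
    fix s assume s: "s \<in> {0..T}"
    show "norm (K s (H s (v s - v0))) \<le> c\<^sup>2 * (2 * k * (N + c\<^sup>2 * T * norm v0))"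
      using norm_KH[OF s, of "v s - v0"] mult_left_mono[OF near'[OF s], of "c\<^sup>2"] by simp
  qed
  finally show ?thesis
    by (simp add: int_const power2_eq_square mult_ac)
qed

text \<open>
  With \<open>K s\<close> the adjoint of \<open>H s\<close> this is the observability Gramian. The two families are kept separate
  so that the estimates for a sweep can be read in reversed time too.
\<close>

definition gramian ::
  "(real \<Rightarrow> 'a \<Rightarrow>\<^sub>L 'b) \<Rightarrow> (real \<Rightarrow> 'b::real_normed_vector \<Rightarrow>\<^sub>L 'a) \<Rightarrow> real \<Rightarrow> 'a::{banach, second_countable_topology} \<Rightarrow> 'a"
  where "gramian H K T x = (LINT s:{0..T}|lebesgue. K s (H s x))"

text \<open>
  The gradient step is a Richardson step for the error \<open>v0 - xs\<close>. Since \<open>\<parallel>v0\<parallel> \<le> \<parallel>v0 - xs\<parallel> + \<parallel>xs\<parallel>\<close>, the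
  remainder of the expansion splits into a multiple of the error and a constant; \<open>L\<close> dominates the
  coefficients of \<open>k\<^sup>2\<close> in both.
\<close>

lemma sweep_error:
  fixes H :: "real \<Rightarrow> 'a::{real_inner, banach, second_countable_topology} \<Rightarrow>\<^sub>L 'b::{banach, second_countable_topology}"
    and K :: "real \<Rightarrow> 'b \<Rightarrow>\<^sub>L 'a"
  assumes T: "0 \<le> T" and c: "0 \<le> c"
    and H_cont: "\<And>x. continuous_on {0..T} (\<lambda>s. H s x)" and H_le: "\<And>s. s \<in> {0..T} \<Longrightarrow> norm (H s) \<le> c"
    and K_cont: "\<And>x. continuous_on {0..T} (\<lambda>s. K s x)" and K_le: "\<And>s. s \<in> {0..T} \<Longrightarrow> norm (K s) \<le> c"
    and \<eta>: "set_integrable lebesgue {0..T} \<eta>" and v_cont: "continuous_on {0..T} v"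
    and v: "\<And>t. t \<in> {0..T} \<Longrightarrow> v t = v0 + k *\<^sub>R (LINT s:{0..t}|lebesgue. K s (\<eta> s - H s (v s)))"
    and k: "0 \<le> k" "k * c\<^sup>2 * T \<le> 1 / 2"
    and lin: "bounded_linear (gramian H K T)" and coercive: "\<And>x. \<delta> * (norm x)\<^sup>2 \<le> gramian H K T x \<bullet> x"
    and W_le: "\<And>x. norm (gramian H K T x) \<le> w * norm x"
    and xs: "gramian H K T xs = (LINT s:{0..T}|lebesgue. K s (\<eta> s))"
  defines "N \<equiv> c * (LINT s:{0..T}|lebesgue. norm (\<eta> s))"
  defines "L \<equiv> w\<^sup>2 + 2 * c\<^sup>2 * T * (c\<^sup>2 * T) + 2 * c\<^sup>2 * T * (N + c\<^sup>2 * T * norm xs)"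
  shows "norm (v T - xs) \<le> (1 - k * \<delta> + k\<^sup>2 * L) * norm (v0 - xs) + k\<^sup>2 * L"
proof -
  interpret W: bounded_linear "gramian H K T" by fact
  let ?b = "LINT s:{0..T}|lebesgue. K s (\<eta> s)"
  define e where "e = norm (v0 - xs)"
  have N: "0 \<le> N"
    unfolding N_def set_lebesgue_integral_def using c by (intro mult_nonneg_nonneg integral_nonneg) auto
  define r where "r = v T - (v0 + k *\<^sub>R (?b - gramian H K T v0))"
  have "norm r \<le> k\<^sup>2 * (2 * c\<^sup>2 * T * (N + c\<^sup>2 * T * norm v0))"
    unfolding r_def N_def gramian_def
    by (rule one_sweep_expansion[OF T c H_cont H_le K_cont K_le \<eta> v_cont v k])
  also have "norm v0 \<le> e + norm xs" unfolding e_def by (metis norm_triangle_sub add.commute)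
  finally have r: "norm r \<le> k\<^sup>2 * (2 * c\<^sup>2 * T * (N + c\<^sup>2 * T * (e + norm xs)))"
    using T by (simp add: mult_left_mono)
  have "v T - xs = (v0 - xs) - k *\<^sub>R gramian H K T (v0 - xs) + r"
    by (simp add: r_def W.diff xs algebra_simps)
  then have "norm (v T - xs) \<le> norm ((v0 - xs) - k *\<^sub>R gramian H K T (v0 - xs)) + norm r"
    by (metis norm_triangle_ineq)
  also have "\<dots> \<le> (1 - k * \<delta> + k\<^sup>2 * w\<^sup>2) * e + k\<^sup>2 * (2 * c\<^sup>2 * T * (N + c\<^sup>2 * T * (e + norm xs)))"
    unfolding e_def by (intro add_mono norm_richardson_step_le coercive W_le k r[unfolded e_def])
  also have "\<dots> = (1 - k * \<delta> + k\<^sup>2 * (w\<^sup>2 + 2 * c\<^sup>2 * T * (c\<^sup>2 * T))) * e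
      + k\<^sup>2 * (2 * c\<^sup>2 * T * (N + c\<^sup>2 * T * norm xs))"
    by (simp add: algebra_simps)
  also have "\<dots> \<le> (1 - k * \<delta> + k\<^sup>2 * L) * e + k\<^sup>2 * L"
    using N T by (intro add_mono mult_right_mono mult_left_mono add_left_mono) (auto simp: L_def e_def)
  finally show ?thesis by (simp add: e_def)
qed

text \<open>
  Once \<open>k n\<close> is small, the factor is at most \<open>1 - \<mu> k n \<le> e\<^sup>-\<^sup>\<mu>\<^sup>k\<^sup>n\<close> with \<open>\<mu> = \<delta> / 2\<close>. Unrolling from a late
  index \<open>m\<close> leaves \<open>a m\<close>, damped to \<open>0\<close> by the divergent sum, and a tail of the convergent sum of squares.
\<close>

lemma recursion_tendsto_0:
  fixes a k :: "nat \<Rightarrow> real"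
  assumes a: "\<And>n. 0 \<le> a n" and k: "\<And>n. 0 \<le> k n"
    and rec: "\<forall>\<^sub>F n in sequentially. a (Suc n) \<le> (1 - k n * \<delta> + (k n)\<^sup>2 * L) * a n + (k n)\<^sup>2 * L"
    and sq: "summable (\<lambda>n. (k n)\<^sup>2)" and div: "filterlim (\<lambda>n. \<Sum>i<n. k i) at_top sequentially"
    and \<delta>: "0 < \<delta>" and L: "0 \<le> L"
  shows "a \<longlonglongrightarrow> 0"
proof -
  define \<mu> where "\<mu> = \<delta> / 2"
  have \<mu>: "0 < \<mu>" using \<delta> by (simp add: \<mu>_def)
  have "(\<lambda>n. sqrt ((k n)\<^sup>2)) \<longlonglongrightarrow> sqrt 0"
    by (intro tendsto_real_sqrt summable_LIMSEQ_zero sq)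
  then have k0: "k \<longlonglongrightarrow> 0" using k by simp
  have "\<forall>\<^sub>F n in sequentially. k n * L < \<mu>" "\<forall>\<^sub>F n in sequentially. \<mu> * k n < 1"
    using order_tendstoD(2)[OF tendsto_mult_left_zero[OF k0, of L], of \<mu>]
      order_tendstoD(2)[OF tendsto_mult_right_zero[OF k0, of \<mu>], of 1] \<mu> by auto
  with rec have "\<forall>\<^sub>F n in sequentially. \<mu> * k n \<le> 1 \<and> a (Suc n) \<le> (1 - \<mu> * k n) * a n + (k n)\<^sup>2 * L"
  proof eventually_elim
    case (elim n)
    have "k n * (k n * L) \<le> k n * \<mu>" using elim(2) k by (intro mult_left_mono) auto
    then have "1 - k n * \<delta> + (k n)\<^sup>2 * L \<le> 1 - \<mu> * k n" by (simp add: \<mu>_def power2_eq_square field_simps)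
    then have "(1 - k n * \<delta> + (k n)\<^sup>2 * L) * a n \<le> (1 - \<mu> * k n) * a n" by (rule mult_right_mono[OF _ a])
    then show ?case using elim by simp
  qed
  then obtain n0 where n0: "\<And>n. n0 \<le> n \<Longrightarrow> \<mu> * k n \<le> 1"
      "\<And>n. n0 \<le> n \<Longrightarrow> a (Suc n) \<le> (1 - \<mu> * k n) * a n + (k n)\<^sup>2 * L"
    unfolding eventually_sequentially by blast
  have unroll: "a n \<le> exp (- \<mu> * (\<Sum>i=m..<n. k i)) * a m + L * (\<Sum>i=m..<n. (k i)\<^sup>2)"
    if m: "n0 \<le> m" "m \<le> n" for m n
    using m(2)
  proof (induction n rule: dec_induct)
    case base
    show ?case by simp
  next
    case (step n)
    let ?E = "exp (- \<mu> * (\<Sum>i=m..<n. k i))" and ?Q = "L * (\<Sum>i=m..<n. (k i)\<^sup>2)"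
    have n: "n0 \<le> n" using m step.hyps by simp
    have Q: "0 \<le> ?Q" using L by (simp add: sum_nonneg)
    have "a (Suc n) \<le> (1 - \<mu> * k n) * a n + (k n)\<^sup>2 * L" by (rule n0(2)[OF n])
    also have "(1 - \<mu> * k n) * a n \<le> (1 - \<mu> * k n) * (?E * a m + ?Q)"
      using n0(1)[OF n] by (intro mult_left_mono step.IH) simp
    also have "\<dots> = (1 - \<mu> * k n) * (?E * a m) + (1 - \<mu> * k n) * ?Q" by (rule distrib_left)
    also have "(1 - \<mu> * k n) * (?E * a m) \<le> exp (- \<mu> * k n) * (?E * a m)"
      using exp_ge_add_one_self[of "- \<mu> * k n"] a by (intro mult_right_mono) auto
    also have "(1 - \<mu> * k n) * ?Q \<le> 1 * ?Q"
      using \<mu> k Q by (intro mult_right_mono) auto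
    also have "exp (- \<mu> * k n) * (?E * a m) = exp (- \<mu> * (\<Sum>i=m..<Suc n. k i)) * a m"
      using step.hyps by (simp add: sum.atLeastLessThan_Suc exp_add[symmetric] mult.assoc[symmetric] algebra_simps)
    finally show ?case using step.hyps by (simp add: sum.atLeastLessThan_Suc algebra_simps)
  qed
  show ?thesis
  proof (rule LIMSEQ_I)
    fix e :: real assume e: "0 < e"
    define q where "q = L + 1"
    have q: "0 < q" "L \<le> q" using L by (auto simp: q_def)
    obtain m' where m': "\<And>m n. m' \<le> m \<Longrightarrow> norm (\<Sum>i=m..<n. (k i)\<^sup>2) < e / (2 * q)"
      using sq[unfolded summable_Cauchy, rule_format, of "e / (2 * q)"] e q by auto
    define m where "m = max n0 m'"
    have tail: "L * (\<Sum>i=m..<n. (k i)\<^sup>2) \<le> e / 2" for n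
    proof -
      have "L * (\<Sum>i=m..<n. (k i)\<^sup>2) \<le> q * (e / (2 * q))"
        using m'[of m n] q L by (intro mult_mono) (auto simp: m_def sum_nonneg)
      then show ?thesis using q by simp
    qed
    have "filterlim (\<lambda>n. - (\<Sum>i<m. k i) + (\<Sum>i<n. k i)) at_top sequentially"
      by (rule filterlim_tendsto_add_at_top[OF tendsto_const div])
    then have "filterlim (\<lambda>n. \<mu> * (- (\<Sum>i<m. k i) + (\<Sum>i<n. k i))) at_top sequentially"
      by (rule filterlim_tendsto_pos_mult_at_top[OF tendsto_const \<mu>])
    then have "(\<lambda>n. exp (- (\<mu> * (- (\<Sum>i<m. k i) + (\<Sum>i<n. k i))))) \<longlonglongrightarrow> 0"
      by (intro filterlim_compose[OF exp_at_bot] filterlim_compose[OF filterlim_uminus_at_bot_at_top])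
    then have "(\<lambda>n. exp (- (\<mu> * (- (\<Sum>i<m. k i) + (\<Sum>i<n. k i)))) * a m) \<longlonglongrightarrow> 0"
      by (rule tendsto_mult_left_zero)
    then have "\<forall>\<^sub>F n in sequentially. exp (- (\<mu> * (- (\<Sum>i<m. k i) + (\<Sum>i<n. k i)))) * a m < e / 2"
      by (rule order_tendstoD(2)) (use e in simp)
    then have "\<forall>\<^sub>F n in sequentially. norm (a n - 0) < e"
      using eventually_ge_at_top[of m]
    proof eventually_elim
      case (elim n)
      have "(\<Sum>i=m..<n. k i) = - (\<Sum>i<m. k i) + (\<Sum>i<n. k i)"
        using elim(2) by (simp add: sum_diff_nat_ivl lessThan_atLeast0 flip: sum.atLeastLessThan_concat[of 0 m n])
      then have "a n \<le> exp (- (\<mu> * (- (\<Sum>i<m. k i) + (\<Sum>i<n. k i)))) * a m + L * (\<Sum>i=m..<n. (k i)\<^sup>2)"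
        using unroll[of m n] elim(2) by (simp add: m_def)
      then show ?case using elim(1) tail[of n] a[of n] by simp
    qed
    then show "\<exists>no. \<forall>n\<ge>no. norm (a n - 0) < e" by (simp add: eventually_sequentially)
  qed
qed

section \<open>Pulling the observers back to time zero\<close>

text \<open>
  The semigroups of \<open>A\<close>, \<open>A\<^sup>*\<close> and \<open>- A\<close> that \<open>contraction_semigroup_inverse\<close> provides.
\<close>

locale contraction_group =
  fixes D :: "'a::{real_inner, banach, second_countable_topology} set" and A :: "'a \<Rightarrow> 'a"
    and S U :: "real \<Rightarrow> 'a \<Rightarrow>\<^sub>L 'a"
  assumes gen_S: "generates D A S" and S_le: "\<And>t. 0 \<le> t \<Longrightarrow> norm (S t) \<le> 1"
    and gen_adj: "generates (adj_dom D A) (adj_op D A) (\<lambda>t. adj_blinfun (S t))"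
    and gen_U: "generates D (\<lambda>x. - A x) U"
    and US: "\<And>t x. 0 \<le> t \<Longrightarrow> U t (S t x) = x" and SU: "\<And>t x. 0 \<le> t \<Longrightarrow> S t (U t x) = x"

locale observed_group = contraction_group D A S U
  for D :: "'a::{real_inner, banach, second_countable_topology} set" and A S U +
  fixes C :: "'a \<Rightarrow>\<^sub>L 'b::{real_inner, banach, second_countable_topology}"
    and T :: real and f :: "real \<Rightarrow> 'a" and y :: "real \<Rightarrow> 'b"
  assumes T: "0 < T" and f: "set_integrable lebesgue {0..T} f" and y: "L2_on {0..T} y"
begin

text \<open>
  The output at time \<open>s\<close> as a function of the initial state, for vanishing load.
\<close>

definition H :: "real \<Rightarrow> 'a \<Rightarrow>\<^sub>L 'b" where "H s = C o\<^sub>L S s"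

text \<open>
  The adjoint of \<open>H s\<close>; it turns an output error into a correction of the initial state.
\<close>

definition K :: "real \<Rightarrow> 'b \<Rightarrow>\<^sub>L 'a" where "K s = adj_blinfun (S s) o\<^sub>L adj_blinfun C"

text \<open>
  The accumulated load transported back to time \<open>0\<close>: the solution started at \<open>x\<close> is \<open>S t (x + F t)\<close>.
\<close>

definition F :: "real \<Rightarrow> 'a" where "F t = (LINT s:{0..t}|lebesgue. U s (f s))"

text \<open>
  The measured output minus \<open>C z[0]\<close>, the output that the load produces from the initial state \<open>0\<close>.
\<close>

definition reduced_output :: "real \<Rightarrow> 'b" where "reduced_output s = y s - C (S s (F s))"

lemmas S = generates_semigroup[OF gen_S] and U = generates_semigroup[OF gen_U]
  and S_adj = generates_semigroup[OF gen_adj]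

lemma H_apply: "H s x = C (S s x)" by (simp add: H_def)

lemma K_apply: "K s w = adj_blinfun (S s) (adj_blinfun C w)" by (simp add: K_def)

lemma inner_K: "K s w \<bullet> x = w \<bullet> H s x"
  by (simp add: H_apply K_apply inner_adj_blinfun')

lemma S_diff: "0 \<le> s \<Longrightarrow> s \<le> t \<Longrightarrow> S (t - s) x = S t (U s x)"
  using C0_semigroup_add[OF S, of "t - s" s "U s x"] by (simp add: SU)

lemma U_diff: "0 \<le> s \<Longrightarrow> s \<le> t \<Longrightarrow> t \<le> r \<Longrightarrow> U (r - t) (U (t - s) x) = U (r - s) x"
  using C0_semigroup_add[OF U, of "r - t" "t - s" x] by simp

text \<open>
  This is where the choice \<open>P t = S t (S t)\<^sup>*\<close> enters: transported back to time \<open>0\<close>, the feedback becomes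
  the adjoint of the observation.
\<close>

lemma U_correction: "0 \<le> t \<Longrightarrow> U t (correction D A t (adjoint C w)) = K t w"
  by (simp add: correction_def sg_exp_eq[OF gen_S] sg_exp_eq[OF gen_adj] US K_apply adj_blinfun_apply[of C])

lemma S_cont: "continuous_on {0..T} (\<lambda>s. S s x)" and U_cont: "continuous_on {0..T} (\<lambda>s. U s x)"
  and S_adj_cont: "continuous_on {0..T} (\<lambda>s. adj_blinfun (S s) x)"
  by (rule C0_semigroup_continuous_on[OF S] C0_semigroup_continuous_on[OF U] C0_semigroup_continuous_on[OF S_adj], auto)+

lemma H_cont: "continuous_on {0..T} (\<lambda>s. H s x)"
  unfolding H_apply by (intro continuous_intros S_cont)

lemma K_cont: "continuous_on {0..T} (\<lambda>s. K s x)"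
  unfolding K_apply by (rule S_adj_cont)

lemma H_le: "s \<in> {0..T} \<Longrightarrow> norm (H s) \<le> norm C"
  unfolding H_def using norm_blinfun_compose[of C "S s"] mult_left_mono[OF S_le[of s], of "norm C"] by simp

lemma K_le: "s \<in> {0..T} \<Longrightarrow> norm (K s) \<le> norm C"
proof -
  assume s: "s \<in> {0..T}"
  have "norm (K s) \<le> norm (adj_blinfun (S s)) * norm (adj_blinfun C)"
    unfolding K_def by (rule norm_blinfun_compose)
  also have "\<dots> \<le> 1 * norm C"
    using S_le[of s] norm_adj_blinfun_le[of "S s"] norm_adj_blinfun_le[of C] s by (intro mult_mono) auto
  finally show ?thesis by simp
qed

lemma integrable_U:
  assumes "set_integrable lebesgue {0..T} g"
  shows "set_integrable lebesgue {0..T} (\<lambda>s. U s (g s))"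
proof -
  obtain M where "\<forall>t\<in>{0..T}. norm (U t) \<le> M" using C0_semigroup_bounded[OF U] by blast
  then show ?thesis using T by (intro set_integrable_blinfun_strong[OF _ U_cont _ assms, of M]) auto
qed

lemma integrable_upto:
  fixes g :: "real \<Rightarrow> 'c::{banach, second_countable_topology}"
  shows "set_integrable lebesgue {0..T} g \<Longrightarrow> t \<in> {0..T} \<Longrightarrow> set_integrable lebesgue {0..t} g"
  by (rule set_integrable_subset) auto

lemma mild_forward:
  assumes g: "set_integrable lebesgue {0..T} g" and t: "t \<in> {0..T}"
  shows "mild D A g x t = S t (x + (LINT s:{0..t}|lebesgue. U s (g s)))"
proof -
  have "(LINT s:{0..t}|lebesgue. sg_exp D A (t - s) (g s)) = (LINT s:{0..t}|lebesgue. S t (U s (g s)))"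
    by (rule set_lebesgue_integral_cong) (use t in \<open>auto simp: sg_exp_eq[OF gen_S] S_diff\<close>)
  also have "\<dots> = S t (LINT s:{0..t}|lebesgue. U s (g s))"
    by (rule set_integral_blinfun[OF integrable_upto[OF integrable_U[OF g] t]])
  finally show ?thesis using t by (simp add: mild_def sg_exp_eq[OF gen_S] blinfun.add_right)
qed

text \<open>
  Time \<open>t\<close> of the backward equation is time \<open>T - t\<close> of the original one, so \<open>U (T - t)\<close> transports the
  state back to time \<open>0\<close>.
\<close>

lemma mild_backward:
  assumes g: "set_integrable lebesgue {0..T} g" and t: "t \<in> {0..T}"
  shows "U (T - t) (mild D (\<lambda>x. - A x) g x t) = U T x + (LINT s:{0..t}|lebesgue. U (T - s) (g s))"
proof -
  have int: "set_integrable lebesgue {0..t} (\<lambda>s. U (t - s) (g s))"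
  proof -
    obtain M where M: "\<And>t. t \<in> {0..T} \<Longrightarrow> norm (U t) \<le> M" using C0_semigroup_bounded[OF U] by blast
    show ?thesis
    proof (rule set_integrable_blinfun_strong[OF _ _ _ integrable_upto[OF g t]])
      show "continuous_on {0..t} (\<lambda>s. U (t - s) x)" for x
        by (rule continuous_on_compose2[OF U_cont]) (use t in \<open>auto intro!: continuous_intros\<close>)
      show "norm (U (t - s)) \<le> M" if "s \<in> {0..t}" for s using that t by (intro M) auto
    qed (use t in auto)
  qed
  have "mild D (\<lambda>x. - A x) g x t = U t x + (LINT s:{0..t}|lebesgue. U (t - s) (g s))"
    unfolding mild_def
    by (intro arg_cong2[of _ _ _ _ "(+)"] set_lebesgue_integral_cong) (use t in \<open>auto simp: sg_exp_eq[OF gen_U]\<close>)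
  then have "U (T - t) (mild D (\<lambda>x. - A x) g x t)
      = U (T - t) (U t x) + (LINT s:{0..t}|lebesgue. U (T - t) (U (t - s) (g s)))"
    by (simp add: blinfun.add_right set_integral_blinfun[OF int])
  also have "U (T - t) (U t x) = U T x" using U_diff[of 0 t T x] t by simp
  also have "(LINT s:{0..t}|lebesgue. U (T - t) (U (t - s) (g s))) = (LINT s:{0..t}|lebesgue. U (T - s) (g s))"
    by (rule set_lebesgue_integral_cong) (use t in \<open>auto simp: U_diff\<close>)
  finally show ?thesis .
qed

lemma residual: "s \<in> {0..T} \<Longrightarrow> y s - C (S s (x + F s)) = reduced_output s - H s x"
  by (simp add: reduced_output_def H_apply blinfun.add_right)

text \<open>
  \<open>v t\<close> is the state of the forward observer transported back to time \<open>0\<close>, minus the accumulated load.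
\<close>

lemma forward_sweep:
  assumes sol: "mild_solution D A T (\<lambda>t. f t + k *\<^sub>R correction D A t (adjoint C (y t - C (z t)))) x0 z"
  shows "\<exists>v. continuous_on {0..T} v \<and> z T = S T (v T + F T) \<and>
    (\<forall>t\<in>{0..T}. v t = x0 + k *\<^sub>R (LINT s:{0..t}|lebesgue. K s (reduced_output s - H s (v s))))"
proof -
  define \<phi> where "\<phi> t = k *\<^sub>R correction D A t (adjoint C (y t - C (z t)))" for t
  have g: "set_integrable lebesgue {0..T} (\<lambda>t. f t + \<phi> t)"
    and z: "\<And>t. t \<in> {0..T} \<Longrightarrow> z t = mild D A (\<lambda>t. f t + \<phi> t) x0 t"
    using sol by (simp_all add: mild_solution_def \<phi>_def)
  have \<phi>: "set_integrable lebesgue {0..T} \<phi>" using set_integral_diff(1)[OF g f] by simp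
  note U\<phi> = integrable_U[OF \<phi>]
  define v where "v t = x0 + (LINT s:{0..t}|lebesgue. U s (\<phi> s))" for t
  have zv: "z t = S t (v t + F t)" if t: "t \<in> {0..T}" for t
    unfolding z[OF t] mild_forward[OF g t] v_def F_def blinfun.add_right[of "U _"]
    by (subst set_integral_add(2)[OF integrable_upto[OF integrable_U[OF f] t] integrable_upto[OF U\<phi> t]])
      (simp add: algebra_simps)
  have "v t = x0 + k *\<^sub>R (LINT s:{0..t}|lebesgue. K s (reduced_output s - H s (v s)))" if t: "t \<in> {0..T}" for t
  proof -
    have "(LINT s:{0..t}|lebesgue. U s (\<phi> s)) = (LINT s:{0..t}|lebesgue. k *\<^sub>R K s (reduced_output s - H s (v s)))"
    proof (intro set_lebesgue_integral_cong allI impI)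
      fix s assume "s \<in> {0..t}"
      then have s: "s \<in> {0..T}" using t by auto
      show "U s (\<phi> s) = k *\<^sub>R K s (reduced_output s - H s (v s))"
        using s by (simp add: \<phi>_def blinfun.scaleR_right U_correction zv[OF s] residual[OF s])
    qed simp
    then show ?thesis by (simp add: v_def)
  qed
  moreover have "continuous_on {0..T} v"
    unfolding v_def by (intro continuous_intros continuous_on_indefinite_integral U\<phi>)
  ultimately show ?thesis using zv[of T] T by (intro exI[of _ v]) auto
qed

text \<open>
  The backward observer starts where the forward one has ended, at \<open>S T (u0 + F T)\<close> with \<open>u0 = v T\<close>, so \<open>u\<close>
  continues \<open>v\<close> without a jump. At the end of the sweep time \<open>0\<close> is reached and no transport is left.
\<close>

lemma backward_sweep:
  assumes sol: "mild_solution D (\<lambda>x. - A x) T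
      (\<lambda>t. - f (T - t) + k *\<^sub>R correction D A (T - t) (adjoint C (y (T - t) - C (z t)))) (S T (u0 + F T)) z"
  shows "\<exists>u. continuous_on {0..T} u \<and> z T = u T \<and>
    (\<forall>t\<in>{0..T}. u t = u0 + k *\<^sub>R (LINT s:{0..t}|lebesgue. K (T - s) (reduced_output (T - s) - H (T - s) (u s))))"
proof -
  define \<psi> where "\<psi> t = k *\<^sub>R correction D A (T - t) (adjoint C (y (T - t) - C (z t)))" for t
  have g: "set_integrable lebesgue {0..T} (\<lambda>t. - f (T - t) + \<psi> t)"
    and z: "\<And>t. t \<in> {0..T} \<Longrightarrow> z t = mild D (\<lambda>x. - A x) (\<lambda>t. - f (T - t) + \<psi> t) (S T (u0 + F T)) t"
    using sol by (simp_all add: mild_solution_def \<psi>_def)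
  have fT: "set_integrable lebesgue {0..T} (\<lambda>t. f (T - t))"
    by (rule set_integrable_reflect) (use f in simp)
  have \<psi>: "set_integrable lebesgue {0..T} \<psi>" using set_integral_add(1)[OF g fT] by simp
  have integrable_UT: "set_integrable lebesgue {0..T} (\<lambda>s. U (T - s) (g s))"
    if "set_integrable lebesgue {0..T} g" for g
  proof -
    have "set_integrable lebesgue {0..T} (\<lambda>s. g (T - s))" by (rule set_integrable_reflect) (use that in simp)
    from integrable_U[OF this] have "set_integrable lebesgue {T - T..T - 0} (\<lambda>s. U s (g (T - s)))" by simp
    from set_integrable_reflect[OF this] show ?thesis by simp
  qed
  note U\<psi> = integrable_UT[OF \<psi>]
  define u where "u t = u0 + (LINT s:{0..t}|lebesgue. U (T - s) (\<psi> s))" for t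
  have zu: "z t = S (T - t) (u t + F (T - t))" if t: "t \<in> {0..T}" for t
  proof -
    have "U (T - t) (z t) = U T (S T (u0 + F T)) + (LINT s:{0..t}|lebesgue. U (T - s) (- f (T - s) + \<psi> s))"
      unfolding z[OF t] by (rule mild_backward[OF g t])
    also have "U T (S T (u0 + F T)) = u0 + F T" using T by (simp add: US)
    also have "(LINT s:{0..t}|lebesgue. U (T - s) (- f (T - s) + \<psi> s))
        = (LINT s:{0..t}|lebesgue. U (T - s) (\<psi> s)) - (LINT s:{0..t}|lebesgue. U (T - s) (f (T - s)))"
      unfolding blinfun.add_right blinfun.minus_right
      by (subst set_integral_diff(2)[symmetric, OF integrable_upto[OF U\<psi> t] integrable_upto[OF integrable_UT[OF fT] t]]) simp
    also have "(LINT s:{0..t}|lebesgue. U (T - s) (f (T - s))) = (LINT s:{T - t..T}|lebesgue. U s (f s))"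
    proof -
      have "set_integrable lebesgue {T - t..T - 0} (\<lambda>s. U s (f s))"
        by (rule set_integrable_subset[OF integrable_U[OF f]]) (use t in auto)
      from set_integral_reflect[OF this] show ?thesis by simp
    qed
    also have "\<dots> = F T - F (T - t)"
      unfolding F_def by (subst set_integral_split[OF integrable_U[OF f], of "T - t"]) (use t in auto)
    finally have "U (T - t) (z t) = u t + F (T - t)" by (simp add: u_def)
    then have "S (T - t) (U (T - t) (z t)) = S (T - t) (u t + F (T - t))" by simp
    then show ?thesis using t by (simp add: SU)
  qed
  have "u t = u0 + k *\<^sub>R (LINT s:{0..t}|lebesgue. K (T - s) (reduced_output (T - s) - H (T - s) (u s)))"
    if t: "t \<in> {0..T}" for t
  proof -
    have "(LINT s:{0..t}|lebesgue. U (T - s) (\<psi> s))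
        = (LINT s:{0..t}|lebesgue. k *\<^sub>R K (T - s) (reduced_output (T - s) - H (T - s) (u s)))"
    proof (intro set_lebesgue_integral_cong allI impI)
      fix s assume "s \<in> {0..t}"
      then have s: "s \<in> {0..T}" "T - s \<in> {0..T}" using t by auto
      show "U (T - s) (\<psi> s) = k *\<^sub>R K (T - s) (reduced_output (T - s) - H (T - s) (u s))"
        using s by (simp add: \<psi>_def blinfun.scaleR_right U_correction zu[OF s(1)] residual[OF s(2)])
    qed simp
    then show ?thesis by (simp add: u_def)
  qed
  moreover have "continuous_on {0..T} u"
    unfolding u_def by (intro continuous_intros continuous_on_indefinite_integral U\<psi>)
  moreover have "z T = u T"
  proof -
    have "F 0 = 0" using set_integral_split[OF integrable_U[OF f], of 0] T by (simp add: F_def)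
    then show ?thesis using zu[of T] T by (simp add: C0_semigroup_0[OF S])
  qed
  ultimately show ?thesis by (intro exI[of _ u]) auto
qed

section \<open>Normal equation and convergence\<close>

lemma F_cont: "continuous_on {0..T} F"
  unfolding F_def by (intro continuous_on_indefinite_integral integrable_U f)

lemma S_apply_cont: "continuous_on {0..T} v \<Longrightarrow> continuous_on {0..T} (\<lambda>s. S s (v s))"
  unfolding continuous_on_def
proof
  fix t assume v: "\<forall>t\<in>{0..T}. (v \<longlongrightarrow> v t) (at t within {0..T})" and t: "t \<in> {0..T}"
  show "((\<lambda>s. S s (v s)) \<longlongrightarrow> S t (v t)) (at t within {0..T})"
  proof (rule tendsto_blinfun_strong)
    show "((\<lambda>s. S s (v t)) \<longlongrightarrow> S t (v t)) (at t within {0..T})"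
      using S_cont t by (simp add: continuous_on_def)
    show "\<forall>\<^sub>F s in at t within {0..T}. norm (S s) \<le> 1" by (auto simp: eventually_at_filter S_le)
  qed (use v t in blast)
qed

lemma residual_L2: "set_integrable lebesgue {0..T} (\<lambda>s. (norm (reduced_output s - H s x))\<^sup>2)"
proof -
  have "set_integrable lebesgue {0..T} (\<lambda>s. (norm (y s - C (S s (x + F s))))\<^sup>2)"
    by (intro L2_minus_continuous y continuous_intros S_apply_cont F_cont)
  then show ?thesis by (subst set_integrable_cong[OF refl refl]) (auto simp: residual)
qed

lemma integrable_reduced_output: "set_integrable lebesgue {0..T} reduced_output"
  unfolding reduced_output_def
  by (intro set_integral_diff(1) L2_on_integrable y set_integrable_continuous_on continuous_intros S_apply_cont F_cont)

lemma integrable_K: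
  "set_integrable lebesgue {0..T} w \<Longrightarrow> set_integrable lebesgue {0..T} (\<lambda>s. K s (w s))"
  using T by (intro set_integrable_blinfun_strong[OF _ K_cont K_le]) auto

lemma integrable_H: "set_integrable lebesgue {0..T} (\<lambda>s. H s x)"
  by (intro set_integrable_continuous_on H_cont)

lemma cost_eq: "cost D A T f y C x = 1/2 * (LINT s:{0..T}|lebesgue. (norm (reduced_output s - H s x))\<^sup>2)"
proof -
  have "(LINT s:{0..T}|lebesgue. (norm (y s - C (mild D A f x s)))\<^sup>2)
      = (LINT s:{0..T}|lebesgue. (norm (reduced_output s - H s x))\<^sup>2)"
    by (rule set_lebesgue_integral_cong) (auto simp: mild_forward[OF f] residual simp flip: F_def)
  then show ?thesis by (simp add: cost_def)
qed

abbreviation W :: "'a \<Rightarrow> 'a" where "W \<equiv> gramian H K T"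

lemma inner_gramian: "W x \<bullet> x = (LINT s:{0..T}|lebesgue. (norm (C (sg_exp D A s x)))\<^sup>2)"
proof -
  have "W x \<bullet> x = (LINT s:{0..T}|lebesgue. K s (H s x) \<bullet> x)"
    unfolding gramian_def by (rule set_integral_inner_left(1)[symmetric, OF integrable_K[OF integrable_H]])
  also have "\<dots> = (LINT s:{0..T}|lebesgue. (norm (C (sg_exp D A s x)))\<^sup>2)"
    by (rule set_lebesgue_integral_cong)
      (auto simp: inner_K dot_square_norm H_apply sg_exp_eq[OF gen_S])
  finally show ?thesis .
qed

lemma norm_gramian_le: "norm (W x) \<le> ((norm C)\<^sup>2 * T) * norm x"
proof -
  have "norm (W x) \<le> (LINT s:{0..T}|lebesgue. (norm C)\<^sup>2 * norm x)"
    unfolding gramian_def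
  proof (rule norm_set_integral_le[OF integrable_K[OF integrable_H]])
    show "set_integrable lebesgue {0..T} (\<lambda>s. (norm C)\<^sup>2 * norm x)"
      by (intro set_integrable_continuous_on continuous_intros)
    fix s assume s: "s \<in> {0..T}"
    have "norm (K s (H s x)) \<le> norm (K s) * norm (H s x)" by (rule norm_blinfun)
    also have "\<dots> \<le> norm C * (norm C * norm x)"
      using norm_blinfun[of "H s" x] mult_right_mono[OF H_le[OF s], of "norm x"]
      by (intro mult_mono K_le[OF s]) auto
    finally show "norm (K s (H s x)) \<le> (norm C)\<^sup>2 * norm x" by (simp add: power2_eq_square)
  qed
  then show ?thesis using T by (simp add: set_integral_const mult_ac)
qed

lemma bounded_linear_gramian: "bounded_linear W"
proof (rule bounded_linear_intro)
  show "W (u + v) = W u + W v" for u v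
    unfolding gramian_def blinfun.add_right
    by (rule set_integral_add(2)[OF integrable_K[OF integrable_H] integrable_K[OF integrable_H]])
  show "W (r *\<^sub>R u) = r *\<^sub>R W u" for r u
    unfolding gramian_def blinfun.scaleR_right by simp
  show "norm (W u) \<le> norm u * ((norm C)\<^sup>2 * T)" for u
    using norm_gramian_le[of u] by (simp add: mult.commute)
qed

text \<open>
  At a solution of the normal equation the first-order term
  \<open>\<integral> \<langle>reduced_output - H xs, H (x - xs)\<rangle> = \<langle>b - W xs, x - xs\<rangle>\<close> vanishes.
\<close>

lemma cost_expansion:
  assumes xs: "W xs = (LINT s:{0..T}|lebesgue. K s (reduced_output s))"
  shows "cost D A T f y C x = cost D A T f y C xs + 1/2 * (W (x - xs) \<bullet> (x - xs))"
proof -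
  define e where "e = x - xs"
  define \<rho> where "\<rho> s = reduced_output s - H s xs" for s
  have \<rho>: "set_integrable lebesgue {0..T} \<rho>"
    unfolding \<rho>_def by (intro set_integral_diff(1) integrable_reduced_output integrable_H)
  have K\<rho>: "(LINT s:{0..T}|lebesgue. K s (\<rho> s)) = 0"
    unfolding \<rho>_def blinfun.diff_right
    by (subst set_integral_diff(2)[OF integrable_K[OF integrable_reduced_output] integrable_K[OF integrable_H]])
      (simp add: xs flip: gramian_def)
  have cross: "(LINT s:{0..T}|lebesgue. K s (\<rho> s) \<bullet> e) = 0"
    "set_integrable lebesgue {0..T} (\<lambda>s. K s (\<rho> s) \<bullet> e)"
    using set_integral_inner_left[OF integrable_K[OF \<rho>], of e] K\<rho> by simp_all
  have quad: "(LINT s:{0..T}|lebesgue. K s (H s e) \<bullet> e) = W e \<bullet> e"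
    "set_integrable lebesgue {0..T} (\<lambda>s. K s (H s e) \<bullet> e)"
    using set_integral_inner_left[OF integrable_K[OF integrable_H], of e e] by (simp_all add: gramian_def)
  have "(LINT s:{0..T}|lebesgue. (norm (reduced_output s - H s x))\<^sup>2)
      = (LINT s:{0..T}|lebesgue. ((norm (\<rho> s))\<^sup>2 - 2 * (K s (\<rho> s) \<bullet> e)) + K s (H s e) \<bullet> e)"
  proof (intro set_lebesgue_integral_cong allI impI)
    fix s
    have "reduced_output s - H s x = \<rho> s - H s e" by (simp add: \<rho>_def e_def blinfun.diff_right)
    then show "(norm (reduced_output s - H s x))\<^sup>2 = ((norm (\<rho> s))\<^sup>2 - 2 * (K s (\<rho> s) \<bullet> e)) + K s (H s e) \<bullet> e"
      using dot_norm_neg[of "\<rho> s" "H s e"] by (simp add: inner_K dot_square_norm)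
  qed simp
  also have "\<dots> = (LINT s:{0..T}|lebesgue. (norm (\<rho> s))\<^sup>2) + W e \<bullet> e"
    using residual_L2[of xs] cross quad
    by (subst set_integral_add(2) set_integral_diff(2), auto simp: \<rho>_def)+
  finally show ?thesis by (simp add: cost_eq \<rho>_def e_def)
qed

text \<open>
  The forward and the backward sweep both contract the error by \<open>\<rho> = 1 - k \<delta> + k\<^sup>2 L\<close> up to a remainder
  \<open>k\<^sup>2 L\<close>, with the same Gramian and the same right-hand side, since reversing time changes neither
  integral. One of the two factors \<open>\<rho> \<le> 1\<close> is given away, and the two remainders add up to \<open>k\<^sup>2 (2 L)\<close>.
\<close>

lemma iteration_error:
  assumes coercive: "\<And>x. \<delta> * (norm x)\<^sup>2 \<le> W x \<bullet> x"
    and xs: "W xs = (LINT s:{0..T}|lebesgue. K s (reduced_output s))"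
  defines "N \<equiv> norm C * (LINT s:{0..T}|lebesgue. norm (reduced_output s))"
  defines "L \<equiv> ((norm C)\<^sup>2 * T)\<^sup>2 + 2 * (norm C)\<^sup>2 * T * ((norm C)\<^sup>2 * T)
    + 2 * (norm C)\<^sup>2 * T * (N + (norm C)\<^sup>2 * T * norm xs)"
  assumes k: "0 \<le> k" "k * (norm C)\<^sup>2 * T \<le> 1 / 2" "k * \<delta> \<le> 1" "k * L \<le> \<delta>"
    and fwd: "mild_solution D A T (\<lambda>t. f t + k *\<^sub>R correction D A t (adjoint C (y t - C (zp t)))) x zp"
    and bwd: "mild_solution D (\<lambda>x. - A x) T
      (\<lambda>t. - f (T - t) + k *\<^sub>R correction D A (T - t) (adjoint C (y (T - t) - C (zm t)))) (zp T) zm"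
  shows "norm (zm T - xs) \<le> (1 - k * \<delta> + k\<^sup>2 * (2 * L)) * norm (x - xs) + k\<^sup>2 * (2 * L)"
proof -
  have T0: "0 \<le> T" using T by simp
  define \<rho> where "\<rho> = 1 - k * \<delta> + k\<^sup>2 * L"
  have N: "0 \<le> N"
    unfolding N_def set_lebesgue_integral_def by (intro mult_nonneg_nonneg integral_nonneg) auto
  have L: "0 \<le> L" unfolding L_def using N T by simp
  have \<rho>: "0 \<le> \<rho>" "\<rho> \<le> 1" "\<rho> \<le> 1 - k * \<delta> + k\<^sup>2 * (2 * L)"
    using k L mult_left_mono[OF k(4,1)] by (simp_all add: \<rho>_def power2_eq_square mult.assoc)
  obtain v where v: "continuous_on {0..T} v" "zp T = S T (v T + F T)"
      "\<And>t. t \<in> {0..T} \<Longrightarrow> v t = x + k *\<^sub>R (LINT s:{0..t}|lebesgue. K s (reduced_output s - H s (v s)))"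
    using forward_sweep[OF fwd] by blast
  have v_err: "norm (v T - xs) \<le> \<rho> * norm (x - xs) + k\<^sup>2 * L"
    unfolding \<rho>_def L_def N_def
    by (rule sweep_error[OF T0 norm_ge_zero H_cont H_le K_cont K_le integrable_reduced_output v(1,3) k(1,2) bounded_linear_gramian
          coercive norm_gramian_le xs])
  obtain u where u: "continuous_on {0..T} u" "zm T = u T"
      "\<And>t. t \<in> {0..T} \<Longrightarrow> u t = v T + k *\<^sub>R (LINT s:{0..t}|lebesgue. K (T - s) (reduced_output (T - s) - H (T - s) (u s)))"
    using backward_sweep[OF bwd[unfolded v(2)]] by blast
  have refl_int: "(LINT s:{0..T}|lebesgue. g (T - s)) = (LINT s:{0..T}|lebesgue. g s)"
    if "set_integrable lebesgue {0..T} g" for g :: "real \<Rightarrow> 'c::{banach, second_countable_topology}"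
    using set_integral_reflect[of T T 0 g] that by simp
  have refl_W: "gramian (\<lambda>s. H (T - s)) (\<lambda>s. K (T - s)) T = W"
    unfolding gramian_def by (rule ext) (rule refl_int[OF integrable_K[OF integrable_H]])
  have refl_xs: "W xs = (LINT s:{0..T}|lebesgue. K (T - s) (reduced_output (T - s)))"
    using refl_int[OF integrable_K[OF integrable_reduced_output]] xs by simp
  have refl_N: "N = norm C * (LINT s:{0..T}|lebesgue. norm (reduced_output (T - s)))"
    using refl_int[OF set_integrable_norm'[OF integrable_reduced_output]] by (simp add: N_def)
  have "norm (u T - xs) \<le> \<rho> * norm (v T - xs) + k\<^sup>2 * L"
    unfolding \<rho>_def L_def refl_N
  proof (rule sweep_error[OF T0 norm_ge_zero _ _ _ _ _ u(1,3) k(1,2)])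
    show "continuous_on {0..T} (\<lambda>s. H (T - s) x)" for x
      by (rule continuous_on_compose2[OF H_cont]) (auto intro!: continuous_intros)
    show "continuous_on {0..T} (\<lambda>s. K (T - s) w)" for w
      by (rule continuous_on_compose2[OF K_cont]) (auto intro!: continuous_intros)
    show "set_integrable lebesgue {0..T} (\<lambda>s. reduced_output (T - s))"
      by (rule set_integrable_reflect) (use integrable_reduced_output in simp)
  qed (unfold refl_W, auto intro!: H_le K_le bounded_linear_gramian coercive norm_gramian_le refl_xs)
  also have "\<dots> \<le> \<rho> * (\<rho> * norm (x - xs) + k\<^sup>2 * L) + k\<^sup>2 * L"
    using v_err \<rho> by (intro add_right_mono mult_left_mono)
  also have "\<dots> = \<rho> * (\<rho> * norm (x - xs)) + \<rho> * (k\<^sup>2 * L) + k\<^sup>2 * L" by (simp add: algebra_simps)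
  also have "\<dots> \<le> 1 * (\<rho> * norm (x - xs)) + 1 * (k\<^sup>2 * L) + k\<^sup>2 * L"
    using \<rho> L by (intro add_mono mult_right_mono) auto
  also have "\<dots> \<le> (1 - k * \<delta> + k\<^sup>2 * (2 * L)) * norm (x - xs) + k\<^sup>2 * (2 * L)"
    using mult_right_mono[OF \<rho>(3), of "norm (x - xs)"] by simp
  finally show ?thesis by (simp add: u(2))
qed

end

theorem theorem3p2:
  fixes D :: "'a::{real_inner, banach, second_countable_topology} set"
    and A :: "'a \<Rightarrow> 'a"
    and Q :: "'a \<Rightarrow>\<^sub>L 'a"
    and C :: "'a \<Rightarrow>\<^sub>L 'b::{real_inner, banach, second_countable_topology}"
    and T \<delta> :: real
    and f \<eta> z :: "real \<Rightarrow> 'a"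
    and y \<nu> :: "real \<Rightarrow> 'b"
    and z0 x0 :: 'a
    and \<kappa> :: "nat \<Rightarrow> real"
    and zp zm :: "nat \<Rightarrow> real \<Rightarrow> 'a"
  assumes "T > 0"
    and "generates_contraction D A"
    and "D = adj_dom D A"
    and "\<forall>x\<in>D. A x + adj_op D A x = - Q x"
    and "nonneg_op Q"
    and "\<delta> > 0"
    and "\<forall>x. (LINT t:{0..T}|lebesgue. (norm (C (sg_exp D A t x)))\<^sup>2) \<ge> \<delta> * (norm x)\<^sup>2"
    and "exp (- norm (Q /\<^sub>R 2) * T) * \<delta> - 3 * (norm C)\<^sup>2 * (exp_quot (norm (Q /\<^sub>R 2)) T - T) > 0"
    and "set_integrable lebesgue {0..T} f"
    and "mild_solution D A T (\<lambda>t. f t + \<eta> t) z0 z"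
    and "\<forall>t\<in>{0..T}. y t = C (z t) + \<nu> t"
    and "L2_on {0..T} y"
    and "\<forall>j\<ge>1. \<kappa> j > 0"
    and "filterlim (\<lambda>n. \<Sum>j=1..n. \<kappa> j) at_top sequentially"
    and "summable (\<lambda>j. (\<kappa> (Suc j))\<^sup>2)"
    and "bfn_iteration D A T f y C (correction D A) \<kappa> x0 zp zm"
  shows "\<exists>xs. (\<forall>x. is_arg_min (cost D A T f y C) (\<lambda>x. True) x \<longleftrightarrow> x = xs) \<and>
              (\<lambda>j. zm j T) \<longlonglongrightarrow> xs"
proof -
  obtain S U where "generates D A S" "\<And>t. 0 \<le> t \<Longrightarrow> norm (S t) \<le> 1"
    "generates (adj_dom D A) (adj_op D A) (\<lambda>t. adj_blinfun (S t))"
    "generates D (\<lambda>x. - A x) U"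
    "\<And>t x. 0 \<le> t \<Longrightarrow> U t (S t x) = x" "\<And>t x. 0 \<le> t \<Longrightarrow> S t (U t x) = x"
    using contraction_semigroup_inverse[OF assms(2-4)] by blast
  then interpret observed_group D A S U C T f y
    using assms(1,9,12) by unfold_locales auto
  have coercive: "\<delta> * (norm x)\<^sup>2 \<le> W x \<bullet> x" for x
    using assms(7) by (simp add: inner_gramian)
  obtain xs where xs: "W xs = (LINT s:{0..T}|lebesgue. K s (reduced_output s))"
    using coercive_surj[OF bounded_linear_gramian coercive assms(6)] by blast
  have less: "cost D A T f y C xs < cost D A T f y C x" if "x \<noteq> xs" for x
  proof -
    have "0 < \<delta> * (norm (x - xs))\<^sup>2" using that assms(6) by simp
    then show ?thesis using coercive[of "x - xs"] by (simp add: cost_expansion[OF xs, of x])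
  qed
  then have argmin: "is_arg_min (cost D A T f y C) (\<lambda>x. True) x \<longleftrightarrow> x = xs" for x
    unfolding is_arg_min_def by (metis less_asym less_irrefl)
  \<comment> \<open>Iteration \<open>Suc n\<close> leads from \<open>x n\<close> to \<open>x (Suc n)\<close> with gain \<open>k n\<close>.\<close>
  define x where "x n = (if n = 0 then x0 else zm n T)" for n
  define k where "k n = \<kappa> (Suc n)" for n
  define L where "L = ((norm C)\<^sup>2 * T)\<^sup>2 + 2 * (norm C)\<^sup>2 * T * ((norm C)\<^sup>2 * T)
    + 2 * (norm C)\<^sup>2 * T * (norm C * (LINT s:{0..T}|lebesgue. norm (reduced_output s)) + (norm C)\<^sup>2 * T * norm xs)"
  have L: "0 \<le> L"
    unfolding L_def set_lebesgue_integral_def using T by (intro add_nonneg_nonneg mult_nonneg_nonneg integral_nonneg) auto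
  have k_pos: "0 \<le> k n" for n using assms(13) by (simp add: k_def less_imp_le)
  have k_sq: "summable (\<lambda>n. (k n)\<^sup>2)" using assms(15) by (simp add: k_def)
  have "(\<lambda>n. sqrt ((k n)\<^sup>2)) \<longlonglongrightarrow> sqrt 0"
    by (intro tendsto_real_sqrt summable_LIMSEQ_zero k_sq)
  then have k0: "k \<longlonglongrightarrow> 0" using k_pos by simp
  have small: "\<forall>\<^sub>F n in sequentially. k n * r < e" if "0 < e" for r e
    by (rule order_tendstoD(2)[OF tendsto_mult_left_zero[OF k0] that])
  have "\<forall>\<^sub>F n in sequentially. k n * ((norm C)\<^sup>2 * T) < 1 / 2"
    "\<forall>\<^sub>F n in sequentially. k n * \<delta> < 1" "\<forall>\<^sub>F n in sequentially. k n * L < \<delta>"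
    by (intro small; use assms(6) in simp)+
  then have rec: "\<forall>\<^sub>F n in sequentially.
      norm (x (Suc n) - xs) \<le> (1 - k n * \<delta> + (k n)\<^sup>2 * (2 * L)) * norm (x n - xs) + (k n)\<^sup>2 * (2 * L)"
  proof eventually_elim
    case (elim n)
    show "norm (x (Suc n) - xs) \<le> (1 - k n * \<delta> + (k n)\<^sup>2 * (2 * L)) * norm (x n - xs) + (k n)\<^sup>2 * (2 * L)"
    proof -
      have "mild_solution D A T (\<lambda>t. f t + k n *\<^sub>R correction D A t (adjoint C (y t - C (zp (Suc n) t)))) (x n) (zp (Suc n))"
        and "mild_solution D (\<lambda>x. - A x) T
          (\<lambda>t. - f (T - t) + k n *\<^sub>R correction D A (T - t) (adjoint C (y (T - t) - C (zm (Suc n) t))))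
          (zp (Suc n) T) (zm (Suc n))"
        using assms(16) unfolding bfn_iteration_def k_def x_def by (auto dest: spec[of _ "Suc n"])
      from iteration_error[OF coercive xs k_pos _ _ _ this] elim
      show ?thesis by (simp add: x_def L_def mult.assoc)
    qed
  qed
  have div: "filterlim (\<lambda>n. \<Sum>i<n. k i) at_top sequentially"
    using assms(14) by (simp add: k_def sum.atLeast1_atMost_eq)
  have "(\<lambda>n. norm (x n - xs)) \<longlonglongrightarrow> 0"
    by (rule recursion_tendsto_0[OF _ k_pos rec k_sq div assms(6)]) (use L in auto)
  then have "x \<longlonglongrightarrow> xs" by (simp add: tendsto_norm_zero_iff flip: Lim_null)
  then have "(\<lambda>j. zm j T) \<longlonglongrightarrow> xs"
    by (rule Lim_transform_eventually) (auto simp: x_def eventually_sequentially intro!: exI[of _ 1])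
  with argmin show ?thesis by blast
qed

end
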